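(* Let $n\ge 2$ be an integer and let $p\in[1,\infty)$ with $p\ge n-1$. Then there exists a unique positive $L_p$-norm spherical copula in dimension $n$, i.e. a unique copula that is the law of a random vector of the form $X^+=R\cdot U_n^+$ with $R\ge 0$ independent of $U_n^+$. If $p>n-1$, then the radius $R$ satisfies $R^p\sim \mathrm{Beta}\left(\frac{n}{p},\,1-\frac{n-1}{p}\right)$, and hence $R$ has the density $$f_R(r)=\frac{\Gamma(1/p)}{\Gamma(n/p)\,\Gamma\left(1-\frac{n-1}{p}\right)}\; r^{n-1}\,(1-r^p)^{-\frac{n-1}{p}}\,\mathbf{1}_{[0<r<1]}.$$ If $p=n-1$, then the unique positive $L_p$-norm spherical copula satisfies $R=1$ almost surely, and thus $X^+=U_n^+$ almost surely.
   Context: For $p\in[1,\infty)$ and $x\in\mathbb{R}^n$ put $\|x\|_p=(\sum_{i=1}^n|x_i|^p)^{1/p}$. If a random vector $Z$ in $\mathbb{R}^n$ has a density of the form $g(\|x\|_p)$, then $\|Z\|_p$ and $Z/\|Z\|_p$ are independent and the law of $Z/\|Z\|_p$ does not depend on $g$ (one may take, for instance, $Z$ uniformly distributed on the unit ball $\{\|x\|_p<1\}$); this law is called the $L_p$-uniform distribution on the sphere, and $U_n$ denotes a random vector with this law. Let $U_n^+$ be the vector of componentwise absolute values of $U_n$. A random vector has an $L_p$-norm spherical distribution on $\mathbb{R}_+^n=[0,\infty)^n$ if it has the same law as $R\cdot U_n^+$, with $R\ge0$ a real random variable (the radius) independent of $U_n^+$. A copula is a probability distribution on $[0,1]^n$ all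 of whose univariate marginals are uniform on $(0,1)$. A copula is called a positive $L_p$-norm spherical copula if it is an $L_p$-norm spherical distribution on $\mathbb{R}_+^n$. $\mathrm{Beta}(\alpha,\beta)$, for $\alpha,\beta>0$, denotes the distribution on $(0,1)$ with density $\frac{\Gamma(\alpha+\beta)}{\Gamma(\alpha)\Gamma(\beta)}x^{\alpha-1}(1-x)^{\beta-1}$. *)

theory Defs
  imports "HOL-Probability.Probability"
begin

definition lp_norm :: "real \<Rightarrow> real ^ 'n \<Rightarrow> real"
  where "lp_norm p x = (\<Sum>i\<in>UNIV. \<bar>x $ i\<bar> powr p) powr (1 / p)"

text \<open>The law of \<open>Z / \<parallel>Z\<parallel>\<^sub>p\<close> is the same for all \<open>Z\<close> whose density is a function of
  \<open>\<parallel>x\<parallel>\<^sub>p\<close>; we fix the choice of \<open>Z\<close> uniform on the unit ball. At the null set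
  \<open>Z = 0\<close> the quotient takes the irrelevant value \<open>0\<close>.\<close>

definition lp_uniform :: "real \<Rightarrow> (real ^ 'n) measure"
  where "lp_uniform p =
    distr (uniform_measure lborel {z. lp_norm p z < 1}) borel (\<lambda>z. z /\<^sub>R lp_norm p z)"

definition lp_uniform_pos :: "real \<Rightarrow> (real ^ 'n) measure"
  where "lp_uniform_pos p = distr (lp_uniform p) borel (\<lambda>u. \<chi> i. \<bar>u $ i\<bar>)"

text \<open>The constant \<open>indep_var\<close> requires both random variables to have the same value type, so
  independence is expressed by the generated sigma-algebras.\<close>

definition radius_direction :: "'a measure \<Rightarrow> real \<Rightarrow> ('a \<Rightarrow> real) \<Rightarrow> ('a \<Rightarrow> real ^ 'n) \<Rightarrow> bool"
  where "radius_direction M p R U \<longleftrightarrow>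
    prob_space M \<and>
    R \<in> borel_measurable M \<and> U \<in> borel_measurable M \<and>
    (AE \<omega> in M. R \<omega> \<ge> 0) \<and>
    distr M borel U = lp_uniform_pos p \<and>
    prob_space.indep_set M
      {R -` A \<inter> space M | A. A \<in> sets borel} {U -` B \<inter> space M | B. B \<in> sets borel}"

text \<open>Distributions are measures on the Borel sets of \<open>real ^ 'n\<close>. The sample space below can be
  taken to be of type \<open>real \<times> real ^ 'n\<close> without loss of generality, since only the
  joint law of \<open>R\<close> and \<open>U\<close> matters.\<close>

definition lp_spherical_pos :: "real \<Rightarrow> (real ^ 'n) measure \<Rightarrow> bool"
  where "lp_spherical_pos p \<mu> \<longleftrightarrow>
    (\<exists>(M :: (real \<times> real ^ 'n) measure) R U.
      radius_direction M p R U \<and> \<mu> = distr M borel (\<lambda>\<omega>. R \<omega> *\<^sub>R U \<omega>))"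

definition copula :: "(real ^ 'n) measure \<Rightarrow> bool"
  where "copula \<mu> \<longleftrightarrow>
    prob_space \<mu> \<and> sets \<mu> = sets borel \<and>
    (AE x in \<mu>. \<forall>i. 0 \<le> x $ i \<and> x $ i \<le> 1) \<and>
    (\<forall>i. distr \<mu> borel (\<lambda>x. x $ i) = uniform_measure lborel {0<..<1})"

definition beta_density :: "real \<Rightarrow> real \<Rightarrow> real \<Rightarrow> real"
  where "beta_density \<alpha> \<beta> x =
    Gamma (\<alpha> + \<beta>) / (Gamma \<alpha> * Gamma \<beta>) * x powr (\<alpha> - 1) * (1 - x) powr (\<beta> - 1)
      * indicator {0<..<1} x"

end

theory Submission imports Defs begin

text \<open>The coordinates of \<open>R U\<close> are bounded, so their laws are determined by their moments, and by
  independence \<open>E (R U\<^sub>i)\<^sup>k = E R\<^sup>k \<cdot> E U\<^sub>i\<^sup>k\<close>. Hence \<open>R U\<close> is a copula iff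
  \<open>E R\<^sup>k = 1 / ((k + 1) E U\<^sub>i\<^sup>k)\<close> for all \<open>k\<close>, and as \<open>R = \<parallel>R U\<parallel>\<^sub>p \<le> n\<^bsup>1/p\<^esup>\<close> is
  bounded too, this determines the law of \<open>R\<close>. The moments of \<open>U\<^sub>i\<close> come from evaluating
  \<open>\<integral> |z\<^sub>i|\<^sup>k exp (- \<parallel>z\<parallel>\<^sub>p\<^sup>p) dz\<close> twice, as a product integral and in polar form; the
  resulting moments of \<open>R\<close> are those of the \<open>p\<close>-th root of a Beta variable, or of the constant
  \<open>1\<close> when \<open>p = n - 1\<close>.\<close>

section \<open>Power laws and Gamma integrals\<close>

text \<open>Open half-lines form an intersection-stable generator of the Borel sets, so it is enough
  to compare the measures there; finiteness of \<open>c\<close> makes the exhausting half-lines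
  \<open>{..<real i}\<close> finite. The factor \<open>c\<close> is an \<open>ennreal\<close>
  because it will be a weighted ball volume that is known to be finite before its value is
  known.\<close>

lemma power_law_density:
  fixes N :: "real measure"
  assumes sets_N: "sets N = sets borel" and q: "q > 0" and c: "c \<noteq> \<infinity>"
    and N: "\<And>x. emeasure N {..<x} = c * ennreal (if x \<le> 0 then 0 else x powr q)"
  shows "N = density lborel (\<lambda>x. c * ennreal (indicator {0<..} x * (q * x powr (q - 1))))"
proof (rule measure_eqI_generator_eq[where \<Omega> = UNIV and E = "range lessThan" and A = "\<lambda>i. {..<real i}"])
  have "{..<a} \<inter> {..<b} = {..<min a b}" for a b :: real
    by auto
  then show "Int_stable (range (lessThan :: real \<Rightarrow> _))"
    by (auto simp: Int_stable_def)
  have borel: "sets (borel :: real measure) = sigma_sets UNIV (range lessThan)"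
    by (subst borel_Iio) auto
  show "sets N = sigma_sets UNIV (range lessThan)"
    using sets_N borel by simp
  show "sets (density lborel (\<lambda>x. c * ennreal (indicator {0<..} x * (q * x powr (q - 1)))))
      = sigma_sets UNIV (range lessThan)"
    using borel by simp
  show "(\<Union>i. {..<real i}) = UNIV"
    using reals_Archimedean2 by auto
  show "emeasure N {..<real i} \<noteq> \<infinity>" for i
    using c by (auto simp: N ennreal_mult_eq_top_iff)
  fix X :: "real set" assume "X \<in> range lessThan"
  then obtain x where X: "X = {..<x}" by auto
  have "emeasure (density lborel (\<lambda>x. c * ennreal (indicator {0<..} x * (q * x powr (q - 1))))) X
      = (\<integral>\<^sup>+y. c * ennreal (indicator {0<..} y * (q * y powr (q - 1))) * indicator {..<x} y \<partial>lborel)"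
    by (simp add: emeasure_density X)
  also have "\<dots> = c * (\<integral>\<^sup>+y. ennreal (indicator {0<..} y * (q * y powr (q - 1))) * indicator {..<x} y \<partial>lborel)"
    by (subst nn_integral_cmult[symmetric]) (auto simp: mult.assoc)
  also have "(\<integral>\<^sup>+y. ennreal (indicator {0<..} y * (q * y powr (q - 1))) * indicator {..<x} y \<partial>lborel)
      = ennreal (if x \<le> 0 then 0 else x powr q)"
  proof (cases "x \<le> 0")
    case True
    then have "(\<lambda>y. ennreal (indicator {0<..} y * (q * y powr (q - 1))) * indicator {..<x} y) = (\<lambda>y. 0)"
      by (auto simp: indicator_def fun_eq_iff)
    with True show ?thesis by simp
  next
    case False
    have "((\<lambda>y. y powr (q - 1)) has_integral (x powr q / q)) {0..x}"
      using has_integral_powr_from_0[of "q - 1" x] q False by simp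
    from has_integral_mult_right[OF this, of q]
    have "((\<lambda>y. q * y powr (q - 1)) has_integral x powr q) {0..x}"
      using q by simp
    from nn_integral_has_integral_lebesgue'[OF _ this] q
    have "(\<integral>\<^sup>+y. ennreal (q * y powr (q - 1)) * indicator {0..x} y \<partial>lborel) = ennreal (x powr q)"
      by simp
    moreover have "(\<integral>\<^sup>+y. ennreal (indicator {0<..} y * (q * y powr (q - 1))) * indicator {..<x} y \<partial>lborel)
        = (\<integral>\<^sup>+y. ennreal (q * y powr (q - 1)) * indicator {0..x} y \<partial>lborel)"
      using AE_lborel_singleton[of 0] AE_lborel_singleton[of x]
      by (intro nn_integral_cong_AE, eventually_elim) (auto simp: indicator_def)
    ultimately show ?thesis using False by simp
  qed
  finally show "emeasure N X = emeasure (density lborel (\<lambda>x. c * ennreal (indicator {0<..} x * (q * x powr (q - 1))))) X"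
    by (simp add: X N)
qed auto

lemma nn_integral_Gamma:
  assumes "a > (0::real)"
  shows "(\<integral>\<^sup>+x. ennreal (indicator {0<..} x * (x powr (a - 1) * exp (- x))) \<partial>lborel) = ennreal (Gamma a)"
proof -
  have "(\<integral>\<^sup>+x. ennreal (x powr (a - 1) / exp x) * indicator {0..} x \<partial>lborel) = ennreal (Gamma a)"
    using nn_integral_has_integral_lebesgue'[OF _ Gamma_integral_real[OF assms]] by simp
  moreover have "(\<integral>\<^sup>+x. ennreal (indicator {0<..} x * (x powr (a - 1) * exp (- x))) \<partial>lborel)
      = (\<integral>\<^sup>+x. ennreal (x powr (a - 1) / exp x) * indicator {0..} x \<partial>lborel)"
    by (intro nn_integral_cong) (auto simp: indicator_def exp_minus divide_inverse)
  ultimately show ?thesis by simp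
qed

lemma nn_integral_Beta:
  assumes "a > (0::real)" "b > 0"
  shows "(\<integral>\<^sup>+x. ennreal (indicator {0<..<1} x * (x powr (a - 1) * (1 - x) powr (b - 1))) \<partial>lborel)
    = ennreal (Beta a b)"
proof -
  have "(\<integral>\<^sup>+x. ennreal (x powr (a - 1) * (1 - x) powr (b - 1)) * indicator {0..1} x \<partial>lborel) = ennreal (Beta a b)"
    using nn_integral_has_integral_lebesgue'[OF _ has_integral_Beta_real[OF assms]] by simp
  moreover have "(\<integral>\<^sup>+x. ennreal (indicator {0<..<1} x * (x powr (a - 1) * (1 - x) powr (b - 1))) \<partial>lborel)
      = (\<integral>\<^sup>+x. ennreal (x powr (a - 1) * (1 - x) powr (b - 1)) * indicator {0..1} x \<partial>lborel)"
    using AE_lborel_singleton[of 0] AE_lborel_singleton[of 1]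
    by (intro nn_integral_cong_AE, eventually_elim) (auto simp: indicator_def)
  ultimately show ?thesis by simp
qed

text \<open>The density \<open>q * x powr (q - 1)\<close> times \<open>x powr a * exp (- x)\<close>
  is \<open>q\<close> times the integrand of \<open>Gamma (q + a)\<close>. Both evaluations of the
  Gaussian-like integral, coordinatewise and radial, reduce to this.\<close>

lemma nn_integral_power_law_Gamma:
  fixes N :: "real measure"
  assumes "sets N = sets borel" "q > 0" "c \<noteq> \<infinity>" "a \<ge> 0"
    and "\<And>x. emeasure N {..<x} = c * ennreal (if x \<le> 0 then 0 else x powr q)"
  shows "(\<integral>\<^sup>+x. ennreal (x powr a * exp (- x)) \<partial>N) = c * ennreal (q * Gamma (q + a))"
proof -
  have "(\<integral>\<^sup>+x. ennreal (x powr a * exp (- x)) \<partial>N)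
      = (\<integral>\<^sup>+x. c * ennreal (indicator {0<..} x * (q * x powr (q - 1))) * ennreal (x powr a * exp (- x)) \<partial>lborel)"
    by (subst power_law_density[OF assms(1-3,5)]) (auto simp: nn_integral_density)
  also have "\<dots> = (\<integral>\<^sup>+x. (c * ennreal q) * ennreal (indicator {0<..} x * (x powr (q + a - 1) * exp (- x))) \<partial>lborel)"
  proof (intro nn_integral_cong)
    fix x :: real
    have "x powr (q - 1) * x powr a = x powr (q + a - 1)"
      by (simp add: powr_add[symmetric] algebra_simps)
    then show "c * ennreal (indicator {0<..} x * (q * x powr (q - 1))) * ennreal (x powr a * exp (- x))
      = (c * ennreal q) * ennreal (indicator {0<..} x * (x powr (q + a - 1) * exp (- x)))"
      using \<open>q > 0\<close> by (auto simp: indicator_def ennreal_mult[symmetric] mult.assoc algebra_simps)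
  qed
  also have "\<dots> = c * ennreal q * ennreal (Gamma (q + a))"
    using assms by (subst nn_integral_cmult) (auto simp: nn_integral_Gamma)
  finally show ?thesis
    using assms by (simp add: ennreal_mult Gamma_real_pos less_imp_le mult.assoc)
qed

text \<open>The conjunct \<open>0 < x\<close> cannot be dropped: for a negative base
  \<open>powr\<close> is not a root, so \<open>x powr (1 / p)\<close> says nothing about
  \<open>x\<close>.\<close>

lemma powr_less_iff:
  fixes t x p :: real
  assumes "t \<ge> 0" "p > 0"
  shows "t powr p < x \<longleftrightarrow> 0 < x \<and> t < x powr (1 / p)"
proof (cases "x > 0")
  case True
  have eq: "(x powr (1 / p)) powr p = x"
    using assms True by (simp add: powr_powr)
  show ?thesis
  proof
    assume "0 < x \<and> t < x powr (1 / p)"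
    then show "t powr p < x"
      using powr_less_mono2[of p t "x powr (1 / p)"] assms eq by simp
  next
    assume "t powr p < x"
    then show "0 < x \<and> t < x powr (1 / p)"
      using powr_mono2[of p "x powr (1 / p)" t] assms True eq by (auto simp: not_le[symmetric])
  qed
next
  case False
  then show ?thesis using powr_ge_zero[of t p] by linarith
qed

text \<open>The set where \<open>\<bar>t\<bar> powr p < x\<close> is an interval of length
  \<open>2 * x powr (1 / p)\<close>, so the image of Lebesgue measure under
  \<open>\<bar>t\<bar> powr p\<close> is a power law with exponent \<open>1 / p\<close>.\<close>

lemma nn_integral_abs_power_exp:
  assumes p: "p > 0"
  shows "(\<integral>\<^sup>+t. ennreal (\<bar>t\<bar> ^ k * exp (- (\<bar>t\<bar> powr p))) \<partial>lborel) = ennreal (2 / p * Gamma ((real k + 1) / p))"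
proof -
  let ?N = "distr lborel borel (\<lambda>t. \<bar>t\<bar> powr p)"
  have N: "emeasure ?N {..<x} = 2 * ennreal (if x \<le> 0 then 0 else x powr (1 / p))" for x
  proof -
    have "(\<lambda>t::real. \<bar>t\<bar> powr p) -` {..<x} = (if x \<le> 0 then {} else {- (x powr (1 / p))<..<x powr (1 / p)})"
    proof (cases "x \<le> 0")
      case False
      then show ?thesis using p by (auto simp: powr_less_iff)
    qed (use p in \<open>auto simp: powr_less_iff\<close>)
    then show ?thesis
      by (simp add: emeasure_distr ennreal_mult[symmetric] flip: ennreal_numeral)
  qed
  have "(\<integral>\<^sup>+t. ennreal (\<bar>t\<bar> ^ k * exp (- (\<bar>t\<bar> powr p))) \<partial>lborel)
      = (\<integral>\<^sup>+t. ennreal ((\<bar>t\<bar> powr p) powr (real k / p) * exp (- (\<bar>t\<bar> powr p))) \<partial>lborel)"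
    \<comment> \<open>For \<open>k = 0\<close> the integrands differ at \<open>t = 0\<close>, where
      \<open>0 ^ 0 = 1\<close> but \<open>0 powr 0 = 0\<close>.\<close>
    using AE_lborel_singleton[of 0]
    by (intro nn_integral_cong_AE, eventually_elim) (use p in \<open>auto simp: powr_powr powr_realpow\<close>)
  also have "\<dots> = (\<integral>\<^sup>+x. ennreal (x powr (real k / p) * exp (- x)) \<partial>?N)"
    by (simp add: nn_integral_distr)
  also have "\<dots> = 2 * ennreal (1 / p * Gamma (1 / p + real k / p))"
    using p by (intro nn_integral_power_law_Gamma N) auto
  finally show ?thesis
    using p by (simp add: ennreal_mult'[symmetric] add_divide_distrib add.commute flip: ennreal_numeral)
qed

section \<open>The \<open>L\<^sub>p\<close>-norm and radial integration\<close>

lemma measurable_lp_norm [measurable]: "lp_norm p \<in> borel_measurable borel"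
  unfolding lp_norm_def [abs_def] by measurable

lemma lp_norm_nonneg: "lp_norm p z \<ge> 0"
  by (simp add: lp_norm_def)

lemma lp_norm_powr: "p > 0 \<Longrightarrow> lp_norm p z powr p = (\<Sum>i\<in>UNIV. \<bar>z $ i\<bar> powr p)"
  by (auto simp: lp_norm_def powr_powr sum_nonneg)

lemma lp_norm_scaleR:
  assumes "p > 0"
  shows "lp_norm p (c *\<^sub>R z) = \<bar>c\<bar> * lp_norm p z"
proof -
  have "(\<Sum>i\<in>UNIV. \<bar>c * z $ i\<bar> powr p) = \<bar>c\<bar> powr p * (\<Sum>i\<in>UNIV. \<bar>z $ i\<bar> powr p)"
    by (simp add: abs_mult powr_mult sum_distrib_left)
  then show ?thesis
    using assms by (simp add: lp_norm_def powr_mult powr_powr sum_nonneg)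
qed

lemma abs_le_lp_norm:
  assumes "p > 0"
  shows "\<bar>z $ i\<bar> \<le> lp_norm p z"
proof -
  have "\<bar>z $ i\<bar> powr p \<le> (\<Sum>i\<in>UNIV. \<bar>z $ i\<bar> powr p)"
    by (rule member_le_sum) auto
  then have "(\<bar>z $ i\<bar> powr p) powr (1 / p) \<le> lp_norm p z"
    unfolding lp_norm_def using assms by (intro powr_mono2) auto
  then show ?thesis using assms by (simp add: powr_powr)
qed

lemma lp_norm_pos:
  assumes "p > 0" "z \<noteq> 0"
  shows "lp_norm p z > 0"
proof -
  obtain i where "z $ i \<noteq> 0" using assms(2) by (auto simp: vec_eq_iff)
  then show ?thesis using abs_le_lp_norm[OF assms(1), of z i] by linarith
qed

text \<open>This bounds the radius of a copula: a point \<open>R U\<close> of the unit cube has norm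
  \<open>R\<close>.\<close>

lemma lp_norm_le_of_abs_le_1:
  fixes z :: "real ^ 'n"
  assumes "p > 0" "\<And>i. \<bar>z $ i\<bar> \<le> 1"
  shows "lp_norm p z \<le> real CARD('n) powr (1 / p)"
proof -
  have "(\<Sum>i\<in>UNIV. \<bar>z $ i\<bar> powr p) \<le> (\<Sum>i\<in>(UNIV :: 'n set). 1)"
    using assms by (intro sum_mono powr_le1) auto
  then show ?thesis
    unfolding lp_norm_def using assms by (intro powr_mono2) (auto intro: sum_nonneg)
qed

lemma emeasure_lp_ball_finite:
  assumes "p > 0"
  shows "emeasure lborel {z :: real ^ 'n. lp_norm p z < 1} < \<infinity>"
proof (rule emeasure_bounded_finite)
  have "{z :: real ^ 'n. lp_norm p z < 1} \<subseteq> cbox (\<chi> i. - 1) (\<chi> i. 1)"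
  proof
    fix z :: "real ^ 'n" assume "z \<in> {z. lp_norm p z < 1}"
    then have "\<bar>z $ i\<bar> \<le> 1" for i
      using abs_le_lp_norm[OF assms, of z i] by simp
    then show "z \<in> cbox (\<chi> i. - 1) (\<chi> i. 1)"
      by (auto simp: mem_box_cart abs_le_iff minus_le_iff)
  qed
  then show "bounded {z :: real ^ 'n. lp_norm p z < 1}"
    by (rule bounded_subset[OF bounded_cbox])
qed

section \<open>Integration by scaling, by coordinates and along radii\<close>

lemma nn_integral_lborel_scaleR:
  fixes f :: "'a::euclidean_space \<Rightarrow> ennreal"
  assumes [measurable]: "f \<in> borel_measurable borel" and c: "c > 0"
  shows "(\<integral>\<^sup>+z. f z \<partial>lborel) = ennreal (c ^ DIM('a)) * (\<integral>\<^sup>+z. f (c *\<^sub>R z) \<partial>lborel)"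
proof -
  have "(\<integral>\<^sup>+z. f z \<partial>lborel)
      = (\<integral>\<^sup>+z. f z \<partial>density (distr lborel borel (\<lambda>x. 0 + c *\<^sub>R x)) (\<lambda>_. \<bar>c\<bar> ^ DIM('a)))"
    using c by (subst lborel_affine[of c 0]) auto
  also have "\<dots> = ennreal (c ^ DIM('a)) * (\<integral>\<^sup>+z. f (c *\<^sub>R z) \<partial>lborel)"
    using c by (simp add: nn_integral_density nn_integral_distr nn_integral_cmult)
  finally show ?thesis .
qed

text \<open>This is Tonelli over \<open>Basis\<close>, reindexed by the bijection from coordinates
  to the vectors \<open>axis i 1\<close>.\<close>

lemma nn_integral_lborel_vec_prod:
  fixes f :: "'n::finite \<Rightarrow> real \<Rightarrow> ennreal"
  assumes [measurable]: "\<And>i. f i \<in> borel_measurable borel"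
  shows "(\<integral>\<^sup>+z. (\<Prod>i\<in>UNIV. f i (z $ i)) \<partial>(lborel :: (real ^ 'n) measure))
    = (\<Prod>i\<in>UNIV. \<integral>\<^sup>+t. f i t \<partial>lborel)"
proof -
  let ?ax = "\<lambda>i :: 'n. axis i (1 :: real)"
  have inj: "inj ?ax" by (auto simp: inj_on_def axis_eq_axis)
  have Basis: "(Basis :: (real ^ 'n) set) = range ?ax"
    by (auto simp: Basis_vec_def)
  define g where "g b = f (inv ?ax b)" for b
  have g: "g (?ax i) = f i" for i
    by (simp add: g_def inv_f_f[OF inj])
  have "(\<integral>\<^sup>+z. (\<Prod>b\<in>Basis. g b (z \<bullet> b)) \<partial>(lborel :: (real ^ 'n) measure))
      = (\<Prod>b\<in>Basis. \<integral>\<^sup>+t. g b t \<partial>lborel)"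
    by (rule nn_integral_lborel_prod) (auto simp: g_def)
  then show ?thesis
    unfolding Basis by (simp add: prod.reindex[OF inj] g inner_axis)
qed

text \<open>Polar integration without a surface measure. Scaling and homogeneity of degree 0 show
  that the ball of radius \<open>r\<close> has weighted volume \<open>r ^ n\<close> times that of
  the unit ball. Hence \<open>lp_norm p z powr p\<close> follows, under the density
  \<open>h\<close>, a power law with exponent \<open>n / p\<close>, and the Gamma integral
  applies.\<close>

lemma nn_integral_lp_radial:
  fixes h :: "real ^ 'n \<Rightarrow> ennreal"
  assumes [measurable]: "h \<in> borel_measurable borel" and p: "p > 0"
    and homogeneous: "\<And>c z. c > 0 \<Longrightarrow> h (c *\<^sub>R z) = h z"
    and fin: "(\<integral>\<^sup>+z. h z * indicator {z. lp_norm p z < 1} z \<partial>lborel) \<noteq> \<infinity>"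
  shows "(\<integral>\<^sup>+z. h z * ennreal (lp_norm p z ^ k * exp (- (lp_norm p z powr p))) \<partial>lborel)
    = (\<integral>\<^sup>+z. h z * indicator {z. lp_norm p z < 1} z \<partial>lborel)
      * ennreal (real CARD('n) / p * Gamma ((real CARD('n) + real k) / p))"
proof -
  let ?n = "real CARD('n)"
  let ?v = "\<integral>\<^sup>+z. h z * indicator {z. lp_norm p z < 1} z \<partial>lborel"
  let ?N = "distr (density lborel h) borel (\<lambda>z. lp_norm p z powr p)"
  have N: "emeasure ?N {..<x} = ?v * ennreal (if x \<le> 0 then 0 else x powr (?n / p))" for x
  proof -
    have [measurable]: "(\<lambda>z. lp_norm p z powr p) -` {..<x} \<in> sets (borel :: (real ^ 'n) measure)"
      by (rule measurable_sets_borel[of _ borel]) measurable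
    have "emeasure ?N {..<x} = (\<integral>\<^sup>+z. h z * indicator ((\<lambda>z. lp_norm p z powr p) -` {..<x}) z \<partial>lborel)"
      by (simp add: emeasure_distr emeasure_density)
    also have "\<dots> = ?v * ennreal (if x \<le> 0 then 0 else x powr (?n / p))"
    proof (cases "x \<le> 0")
      case True
      then have "(\<lambda>z. lp_norm p z powr p) -` {..<x} = ({} :: (real ^ 'n) set)"
        using p by (auto simp: powr_less_iff lp_norm_nonneg)
      with True show ?thesis by simp
    next
      case False
      define r where "r = x powr (1 / p)"
      have r: "r > 0" using False by (simp add: r_def)
      have "(\<lambda>z. lp_norm p z powr p) -` {..<x} = {z :: real ^ 'n. lp_norm p z < r}"
        using False p by (auto simp: powr_less_iff lp_norm_nonneg r_def)
      then have "(\<integral>\<^sup>+z. h z * indicator ((\<lambda>z. lp_norm p z powr p) -` {..<x}) z \<partial>lborel)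
          = (\<integral>\<^sup>+z. h z * indicator {z. lp_norm p z < r} z \<partial>lborel)"
        by simp
      also have "\<dots> = ennreal (r ^ CARD('n))
          * (\<integral>\<^sup>+z. h (r *\<^sub>R z) * indicator {z. lp_norm p z < r} (r *\<^sub>R z) \<partial>lborel)"
        using r by (subst nn_integral_lborel_scaleR[where c = r]) auto
      also have "(\<lambda>z. h (r *\<^sub>R z) * indicator {z. lp_norm p z < r} (r *\<^sub>R z))
          = (\<lambda>z. h z * indicator {z. lp_norm p z < 1} z)"
        using r p by (auto simp: fun_eq_iff homogeneous lp_norm_scaleR indicator_def)
      also have "r ^ CARD('n) = x powr (?n / p)"
        using r by (simp add: r_def powr_realpow[symmetric] powr_powr)
      finally show ?thesis using False by (simp add: mult.commute)
    qed
    finally show ?thesis .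
  qed
  have "(\<integral>\<^sup>+z. h z * ennreal (lp_norm p z ^ k * exp (- (lp_norm p z powr p))) \<partial>lborel)
      = (\<integral>\<^sup>+z. h z * ennreal ((lp_norm p z powr p) powr (real k / p) * exp (- (lp_norm p z powr p))) \<partial>lborel)"
    using AE_lborel_singleton[of 0]
  proof (intro nn_integral_cong_AE, eventually_elim)
    fix z :: "real ^ 'n" assume "z \<noteq> 0"
    then have "(lp_norm p z powr p) powr (real k / p) = lp_norm p z ^ k"
      using p lp_norm_pos[OF p, of z] by (simp add: powr_powr powr_realpow)
    then show "h z * ennreal (lp_norm p z ^ k * exp (- (lp_norm p z powr p)))
        = h z * ennreal ((lp_norm p z powr p) powr (real k / p) * exp (- (lp_norm p z powr p)))"
      by simp
  qed
  also have "\<dots> = (\<integral>\<^sup>+x. ennreal (x powr (real k / p) * exp (- x)) \<partial>?N)"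
    by (simp add: nn_integral_distr nn_integral_density)
  also have "\<dots> = ?v * ennreal (?n / p * Gamma (?n / p + real k / p))"
    using p fin by (intro nn_integral_power_law_Gamma N) auto
  finally show ?thesis by (simp add: add_divide_distrib)
qed

section \<open>Moments of the \<open>L\<^sub>p\<close>-uniform distribution\<close>

text \<open>The weight is homogeneous of degree 0, so the radial formula turns the integral of
  \<open>\<bar>z $ i\<bar> ^ k * exp (- (lp_norm p z powr p))\<close> into \<open>?v * ?a\<close>.
  The same integral factors over the coordinates and equals \<open>?b\<close>. Since
  \<open>?v\<close> is finite and \<open>?a\<close> positive, the equation can be solved for
  \<open>?v\<close>.\<close>

lemma nn_integral_lp_cone:
  assumes p: "p > 0"
  shows "(\<integral>\<^sup>+z. ennreal ((\<bar>z $ i\<bar> / lp_norm p z) ^ k) * indicator {z :: real ^ 'n. lp_norm p z < 1} z \<partial>lborel)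
    = ennreal ((2 / p) ^ CARD('n) * Gamma (1 / p) ^ (CARD('n) - 1) * Gamma ((real k + 1) / p)
        / (real CARD('n) / p * Gamma ((real CARD('n) + real k) / p)))"
    (is "?v = ennreal (?b / ?a)")
proof -
  let ?h = "\<lambda>z :: real ^ 'n. ennreal ((\<bar>z $ i\<bar> / lp_norm p z) ^ k)"
  have h_le: "?h z \<le> 1" for z
    using abs_le_lp_norm[OF p, of z i] lp_norm_nonneg[of p z]
    by (auto simp: divide_le_eq intro!: power_le_one)
  have "?v \<le> (\<integral>\<^sup>+z. indicator {z :: real ^ 'n. lp_norm p z < 1} z \<partial>lborel)"
    using h_le by (intro nn_integral_mono) (auto simp: indicator_def)
  also have "\<dots> < \<infinity>"
    using emeasure_lp_ball_finite[OF p] by simp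
  finally have fin: "?v \<noteq> \<infinity>" by simp
  have homogeneous: "?h (c *\<^sub>R z) = ?h z" if "c > 0" for c z
    using that by (simp add: lp_norm_scaleR[OF p] abs_mult)
  \<comment> \<open>With these exponents the factors of all coordinates, including the distinguished
    one, have the shape of \<open>nn_integral_abs_power_exp\<close>.\<close>
  define e where "e j = (if j = i then k else 0)" for j
  have "?v * ennreal ?a = (\<integral>\<^sup>+z. ?h z * ennreal (lp_norm p z ^ k * exp (- (lp_norm p z powr p))) \<partial>lborel)"
    using p fin by (intro nn_integral_lp_radial[symmetric] homogeneous) auto
  also have "\<dots> = (\<integral>\<^sup>+z. (\<Prod>j\<in>UNIV. ennreal (\<bar>z $ j\<bar> ^ e j * exp (- (\<bar>z $ j\<bar> powr p)))) \<partial>lborel)"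
    using AE_lborel_singleton[of 0]
  proof (intro nn_integral_cong_AE, eventually_elim)
    fix z :: "real ^ 'n" assume "z \<noteq> 0"
    then have pos: "lp_norm p z > 0" by (rule lp_norm_pos[OF p])
    have "(\<Prod>j\<in>UNIV. \<bar>z $ j\<bar> ^ e j * exp (- (\<bar>z $ j\<bar> powr p)))
        = (\<Prod>j\<in>UNIV. if j = i then \<bar>z $ j\<bar> ^ k else 1) * exp (\<Sum>j\<in>UNIV. - (\<bar>z $ j\<bar> powr p))"
      unfolding exp_sum[OF finite] prod.distrib[symmetric] by (rule prod.cong) (auto simp: e_def)
    also have "\<dots> = \<bar>z $ i\<bar> ^ k * exp (- (lp_norm p z powr p))"
      by (simp add: lp_norm_powr[OF p] sum_negf)
    also have "\<dots> = (\<bar>z $ i\<bar> / lp_norm p z) ^ k * (lp_norm p z ^ k * exp (- (lp_norm p z powr p)))"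
      using pos by (simp add: power_divide)
    finally show "?h z * ennreal (lp_norm p z ^ k * exp (- (lp_norm p z powr p)))
        = (\<Prod>j\<in>UNIV. ennreal (\<bar>z $ j\<bar> ^ e j * exp (- (\<bar>z $ j\<bar> powr p))))"
      using pos by (simp add: prod_ennreal ennreal_mult[symmetric])
  qed
  also have "\<dots> = (\<Prod>j\<in>UNIV. ennreal (2 / p * Gamma ((real (e j) + 1) / p)))"
    using p by (subst nn_integral_lborel_vec_prod) (auto simp: nn_integral_abs_power_exp)
  also have "\<dots> = ennreal (\<Prod>j\<in>UNIV. 2 / p * Gamma ((real (e j) + 1) / p))"
    using p by (intro prod_ennreal) (auto intro!: divide_nonneg_pos mult_nonneg_nonneg less_imp_le[OF Gamma_real_pos])
  also have "(\<Prod>j\<in>UNIV. 2 / p * Gamma ((real (e j) + 1) / p)) = ?b"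
  proof -
    have "(\<Prod>j\<in>UNIV. Gamma ((real (e j) + 1) / p))
        = Gamma ((real (e i) + 1) / p) * (\<Prod>j\<in>UNIV - {i}. Gamma ((real (e j) + 1) / p))"
      by (intro prod.remove) auto
    also have "(\<Prod>j\<in>UNIV - {i}. Gamma ((real (e j) + 1) / p)) = (\<Prod>j\<in>UNIV - {i}. Gamma (1 / p))"
      by (intro prod.cong) (auto simp: e_def)
    finally show ?thesis
      by (simp only: prod.distrib) (simp add: e_def)
  qed
  finally have eq: "?v * ennreal ?a = ennreal ?b" .
  have a: "?a > 0" and b: "?b \<ge> 0"
    using p by (auto intro!: mult_pos_pos mult_nonneg_nonneg divide_pos_pos Gamma_real_pos less_imp_le[OF Gamma_real_pos] add_pos_nonneg)
  obtain r where r: "?v = ennreal r" "r \<ge> 0"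
    using fin by (cases ?v) auto
  have "ennreal (r * ?a) = ennreal ?b"
    using eq less_imp_le[OF a] r(2) unfolding r(1) by (subst ennreal_mult) auto
  moreover have "0 \<le> r * ?a"
    using r(2) less_imp_le[OF a] by (rule mult_nonneg_nonneg)
  ultimately have "r * ?a = ?b"
    using b by (rule_tac ennreal_inj[THEN iffD1])
  then have "r = ?b / ?a"
    using a by (intro eq_divide_imp) auto
  then show ?thesis by (simp only: r(1))
qed

text \<open>This is the \<open>k\<close>-th moment of one coordinate of
  \<open>lp_uniform_pos p\<close> in dimension \<open>n\<close>. It is the quotient of the values of
  \<open>nn_integral_lp_cone\<close> for \<open>k\<close> and for \<open>0\<close>, in which the
  powers of \<open>2 / p\<close> and all but one factor \<open>Gamma (1 / p)\<close> cancel.\<close>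

definition lp_moment :: "real \<Rightarrow> nat \<Rightarrow> nat \<Rightarrow> real"
  where "lp_moment p n k = Gamma ((real k + 1) / p) * Gamma (real n / p)
    / (Gamma (1 / p) * Gamma ((real n + real k) / p))"

lemma lp_moment_pos: "p > 0 \<Longrightarrow> n > 0 \<Longrightarrow> lp_moment p n k > 0"
  by (auto simp: lp_moment_def intro!: divide_pos_pos mult_pos_pos Gamma_real_pos)

text \<open>The volume of the ball is the case \<open>k = 0\<close> of
  \<open>nn_integral_lp_cone\<close>, a quotient of positive Gamma terms.\<close>

lemma emeasure_lp_ball_pos:
  assumes p: "p > 0"
  shows "emeasure lborel {z :: real ^ 'n. lp_norm p z < 1} > 0"
proof -
  have "emeasure lborel {z :: real ^ 'n. lp_norm p z < 1}
      = (\<integral>\<^sup>+z. indicator {z :: real ^ 'n. lp_norm p z < 1} z \<partial>lborel)"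
    by simp
  also have "\<dots> > 0"
    using nn_integral_lp_cone[OF p, where ?'n = 'n and k = 0] p
    by (auto intro!: mult_pos_pos divide_pos_pos Gamma_real_pos zero_less_power)
  finally show ?thesis .
qed

lemma measurable_vec_abs [measurable]: "(\<lambda>u :: real ^ 'n. \<chi> i. \<bar>u $ i\<bar>) \<in> borel_measurable borel"
  by (intro borel_measurable_continuous_onI continuous_intros)

lemma sets_lp_uniform_pos [simp, measurable_cong]: "sets (lp_uniform_pos p) = sets borel"
  by (simp add: lp_uniform_pos_def)

lemma prob_space_lp_uniform_pos:
  assumes "p > 0"
  shows "prob_space (lp_uniform_pos p :: (real ^ 'n) measure)"
  unfolding lp_uniform_pos_def lp_uniform_def
  using emeasure_lp_ball_pos[OF assms, where ?'n = 'n] emeasure_lp_ball_finite[OF assms, where ?'n = 'n]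
  by (intro prob_space.prob_space_distr prob_space_uniform_measure) auto

lemma nn_integral_lp_uniform_pos:
  assumes p: "p > 0"
  shows "(\<integral>\<^sup>+u. ennreal ((u $ i) ^ k) \<partial>(lp_uniform_pos p :: (real ^ 'n) measure))
    = ennreal (lp_moment p CARD('n) k)"
proof -
  let ?B = "{z :: real ^ 'n. lp_norm p z < 1}"
  note cone = nn_integral_lp_cone[OF p, where ?'n = 'n and i = i]
  have abs_lp_norm [simp]: "\<bar>lp_norm p z\<bar> = lp_norm p z" for z :: "real ^ 'n"
    using lp_norm_nonneg[of p z] by simp
  have "(\<integral>\<^sup>+u. ennreal ((u $ i) ^ k) \<partial>(lp_uniform_pos p :: (real ^ 'n) measure))
      = (\<integral>\<^sup>+z. ennreal ((\<bar>z $ i\<bar> / lp_norm p z) ^ k) \<partial>uniform_measure lborel ?B)"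
    unfolding lp_uniform_pos_def lp_uniform_def
    by (simp add: nn_integral_distr abs_mult divide_inverse mult.commute[of _ "inverse _"])
  also have "\<dots> = (\<integral>\<^sup>+z. ennreal ((\<bar>z $ i\<bar> / lp_norm p z) ^ k) * indicator ?B z \<partial>lborel) / emeasure lborel ?B"
    by (rule nn_integral_uniform_measure) auto
  \<comment> \<open>The normalising volume is written as the case \<open>k = 0\<close>, so that one
    formula serves numerator and denominator.\<close>
  also have "emeasure lborel ?B = (\<integral>\<^sup>+z. ennreal ((\<bar>z $ i\<bar> / lp_norm p z) ^ 0) * indicator ?B z \<partial>lborel)"
    by simp
  also have "(\<integral>\<^sup>+z. ennreal ((\<bar>z $ i\<bar> / lp_norm p z) ^ k) * indicator ?B z \<partial>lborel) / \<dots>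
     = ennreal (lp_moment p CARD('n) k)"
  proof -
    let ?G = "\<lambda>x. Gamma (x :: real)"
    let ?n = "real CARD('n)"
    have pos: "?G (1 / p) > 0" "?G (?n / p) > 0" "?G ((?n + real k) / p) > 0" "?G ((real k + 1) / p) > 0"
      using p by (auto intro!: Gamma_real_pos divide_pos_pos add_pos_nonneg)
    show ?thesis
      unfolding cone using pos p
      by (subst divide_ennreal) (auto simp: lp_moment_def field_simps intro!: divide_pos_pos mult_pos_pos)
  qed
  finally show ?thesis .
qed

text \<open>Normalising fails only at \<open>z = 0\<close>, which is a null set.\<close>

lemma AE_lp_uniform_pos:
  assumes p: "p > 0"
  shows "AE u in (lp_uniform_pos p :: (real ^ 'n) measure). lp_norm p u = 1 \<and> (\<forall>i. 0 \<le> u $ i)"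
proof -
  have abs: "lp_norm p (\<chi> i. \<bar>u $ i\<bar>) = lp_norm p u" for u :: "real ^ 'n"
    by (simp add: lp_norm_def)
  have "AE z in uniform_measure lborel {z :: real ^ 'n. lp_norm p z < 1}. z \<noteq> 0"
    using AE_lborel_singleton[of 0]
    by (intro AE_uniform_measureI) auto
  then have "AE z in uniform_measure lborel {z :: real ^ 'n. lp_norm p z < 1}.
      lp_norm p (\<chi> i. \<bar>(z /\<^sub>R lp_norm p z) $ i\<bar>) = 1"
  proof eventually_elim
    fix z :: "real ^ 'n" assume "z \<noteq> 0"
    then show "lp_norm p (\<chi> i. \<bar>(z /\<^sub>R lp_norm p z) $ i\<bar>) = 1"
      using lp_norm_pos[OF p, of z] by (simp only: abs lp_norm_scaleR[OF p]) simp
  qed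
  then show ?thesis
    unfolding lp_uniform_pos_def lp_uniform_def
    by (subst AE_distr_iff, simp, simp, subst AE_distr_iff) auto
qed

section \<open>Bounded laws are determined by their moments\<close>

text \<open>Equal moments give equal Taylor polynomials of the characteristic functions. On
  \<open>[0, C]\<close> the remainder of order \<open>n\<close> is at most
  \<open>2 * ((\<bar>t\<bar> * C) ^ n / fact n)\<close>, which tends to 0, so the characteristic
  functions coincide and Levy's uniqueness theorem applies.\<close>

lemma moment_problem_bounded:
  fixes M N :: "real measure"
  assumes "real_distribution M" "real_distribution N"
    and M_bd: "AE x in M. 0 \<le> x \<and> x \<le> C" and N_bd: "AE x in N. 0 \<le> x \<and> x \<le> C"
    and eq: "\<And>k. (\<integral>\<^sup>+x. ennreal (x ^ k) \<partial>M) = (\<integral>\<^sup>+x. ennreal (x ^ k) \<partial>N)"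
  shows "M = N"
proof -
  have approx: "integrable P (\<lambda>x. x ^ k)"
    "(LINT x|P. x ^ k) = enn2real (\<integral>\<^sup>+x. ennreal (x ^ k) \<partial>P)"
    "cmod (char P t - (\<Sum>k \<le> n. ((\<i> * t) ^ k / fact k) * (LINT x|P. x ^ k)))
      \<le> 2 * ((\<bar>t\<bar> * C) ^ n / fact n)"
    if P: "real_distribution P" and bd: "AE x in P. 0 \<le> x \<and> x \<le> C" for P k t n
  proof -
    interpret real_distribution P by fact
    have ae: "AE x in P. \<bar>x\<bar> ^ k \<le> C ^ k" for k
      using bd by eventually_elim (auto intro: power_mono)
    show int: "integrable P (\<lambda>x. x ^ k)" for k
      using ae[of k] by (intro integrable_const_bound[where B = "C ^ k"]) (auto simp: power_abs)
    have nonneg: "AE x in P. 0 \<le> x ^ k"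
      using bd by eventually_elim auto
    show "(LINT x|P. x ^ k) = enn2real (\<integral>\<^sup>+x. ennreal (x ^ k) \<partial>P)"
      using nonneg by (intro integral_eq_nn_integral) auto
    have "expectation (\<lambda>x. \<bar>x\<bar> ^ n) \<le> expectation (\<lambda>x. C ^ n)"
      using ae[of n] int[of n] by (intro integral_mono_AE) (auto simp: power_abs[symmetric])
    then have "expectation (\<lambda>x. \<bar>x\<bar> ^ n) \<le> C ^ n"
      using prob_space by simp
    then have "2 * \<bar>t\<bar> ^ n / fact n * expectation (\<lambda>x. \<bar>x\<bar> ^ n) \<le> 2 * \<bar>t\<bar> ^ n / fact n * C ^ n"
      by (intro mult_left_mono) auto
    with char_approx1[of n t, OF int]
    show "cmod (char P t - (\<Sum>k \<le> n. ((\<i> * t) ^ k / fact k) * (LINT x|P. x ^ k)))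
      \<le> 2 * ((\<bar>t\<bar> * C) ^ n / fact n)"
      by (simp add: power_mult_distrib)
  qed
  note M = approx[OF assms(1) M_bd] and N = approx[OF assms(2) N_bd]
  have "char M t = char N t" for t
  proof -
    have le: "cmod (char M t - char N t) \<le> 4 * ((\<bar>t\<bar> * C) ^ n / fact n)" for n
    proof -
      \<comment> \<open>The same polynomial approximates both functions; the two remainders add up
        to the factor 4.\<close>
      let ?S = "\<Sum>k \<le> n. ((\<i> * t) ^ k / fact k) * complex_of_real (LINT x|M. x ^ k)"
      have "cmod (char M t - char N t) \<le> cmod (char M t - ?S) + cmod (char N t - ?S)"
        using norm_triangle_ineq4[of "char M t - ?S" "char N t - ?S"] by simp
      moreover have "(LINT x|M. x ^ k) = (LINT x|N. x ^ k)" for k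
        using M(2)[of k] N(2)[of k] eq[of k] by simp
      ultimately show ?thesis using M(3)[of t n] N(3)[of t n] by simp
    qed
    \<comment> \<open>These are, up to the factor 4, the terms of the convergent exponential
      series.\<close>
    have "(\<lambda>n. 4 * ((\<bar>t\<bar> * C) ^ n / fact n)) \<longlonglongrightarrow> 4 * 0"
      using summable_exp[of "\<bar>t\<bar> * C"]
      by (intro tendsto_mult tendsto_const) (auto dest!: summable_LIMSEQ_zero simp: field_simps)
    then have "cmod (char M t - char N t) \<le> 4 * 0"
      by (rule LIMSEQ_le_const) (use le in blast)
    then show ?thesis by simp
  qed
  then show ?thesis using assms by (intro Levy_uniqueness) auto
qed

section \<open>Radius and direction\<close>

lemma measurable_vec_nth [measurable (raw)]:
  "f \<in> borel_measurable M \<Longrightarrow> (\<lambda>x. (f x :: real ^ 'n) $ i) \<in> borel_measurable M"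
  unfolding cart_eq_inner_axis by simp

lemma radius_directionD:
  assumes "radius_direction M p R U"
  shows "prob_space M" "R \<in> borel_measurable M" "U \<in> borel_measurable M"
    "AE \<omega> in M. R \<omega> \<ge> 0" "distr M borel U = lp_uniform_pos p"
  using assms by (auto simp: radius_direction_def)

text \<open>Independence is the product formula on rectangles, and these determine a product of
  probability measures. Consequently the law of \<open>R U\<close> depends on the law of
  \<open>R\<close> alone.\<close>

lemma radius_direction_joint_law:
  fixes U :: "'a \<Rightarrow> real ^ 'n"
  assumes RU: "radius_direction M p R U"
  shows "distr M (borel \<Otimes>\<^sub>M borel) (\<lambda>\<omega>. (R \<omega>, U \<omega>)) = distr M borel R \<Otimes>\<^sub>M lp_uniform_pos p"
proof -
  note [measurable] = radius_directionD(2,3)[OF RU]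
  interpret prob_space M by (rule radius_directionD(1)[OF RU])
  have indep: "indep_set {R -` A \<inter> space M | A. A \<in> sets borel} {U -` B \<inter> space M | B. B \<in> sets borel}"
    using RU by (simp add: radius_direction_def)
  interpret R: prob_space "distr M borel R" by (rule prob_space_distr) simp
  interpret U: prob_space "distr M borel U" by (rule prob_space_distr) simp
  have "distr M borel R \<Otimes>\<^sub>M distr M borel U = distr M (borel \<Otimes>\<^sub>M borel) (\<lambda>\<omega>. (R \<omega>, U \<omega>))"
  proof (rule pair_measure_eqI)
    show "sets (distr M borel R \<Otimes>\<^sub>M distr M borel U) = sets (distr M (borel \<Otimes>\<^sub>M borel) (\<lambda>\<omega>. (R \<omega>, U \<omega>)))"
      by (simp cong: sets_pair_measure_cong)
    fix A B assume "A \<in> sets (distr M borel R)" "B \<in> sets (distr M borel U)"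
    then have [measurable]: "A \<in> sets borel" "B \<in> sets borel" by auto
    have "(\<lambda>\<omega>. (R \<omega>, U \<omega>)) -` (A \<times> B) \<inter> space M = (R -` A \<inter> space M) \<inter> (U -` B \<inter> space M)"
      by auto
    moreover have "prob ((R -` A \<inter> space M) \<inter> (U -` B \<inter> space M)) = prob (R -` A \<inter> space M) * prob (U -` B \<inter> space M)"
      by (rule indep_setD[OF indep]) auto
    ultimately show "emeasure (distr M borel R) A * emeasure (distr M borel U) B
        = emeasure (distr M (borel \<Otimes>\<^sub>M borel) (\<lambda>\<omega>. (R \<omega>, U \<omega>))) (A \<times> B)"
      by (simp add: emeasure_distr emeasure_eq_measure ennreal_mult)
  qed unfold_locales
  then show ?thesis by (simp add: radius_directionD(5)[OF RU])
qed

lemma AE_direction: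
  fixes U :: "'a \<Rightarrow> real ^ 'n"
  assumes RU: "radius_direction M p R U" and p: "p > 0"
  shows "AE \<omega> in M. lp_norm p (U \<omega>) = 1 \<and> (\<forall>i. 0 \<le> U \<omega> $ i)"
proof -
  note [measurable] = radius_directionD(3)[OF RU]
  have "AE u in distr M borel U. lp_norm p u = 1 \<and> (\<forall>i. 0 \<le> u $ i)"
    unfolding radius_directionD(5)[OF RU] by (rule AE_lp_uniform_pos[OF p])
  then show ?thesis by (subst (asm) AE_distr_iff) auto
qed

text \<open>By the product form of the joint law, Tonelli separates the moments of the radius from
  those of a coordinate.\<close>

lemma nn_integral_radius_direction_power:
  fixes U :: "'a \<Rightarrow> real ^ 'n"
  assumes RU: "radius_direction M p R U" and p: "p > 0"
  shows "(\<integral>\<^sup>+\<omega>. ennreal ((R \<omega> * U \<omega> $ i) ^ k) \<partial>M)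
    = (\<integral>\<^sup>+x. ennreal (x ^ k) \<partial>distr M borel R) * ennreal (lp_moment p CARD('n) k)"
proof -
  note [measurable] = radius_directionD(2,3)[OF RU]
  interpret prob_space M by (rule radius_directionD(1)[OF RU])
  interpret U: prob_space "lp_uniform_pos p :: (real ^ 'n) measure"
    by (rule prob_space_lp_uniform_pos[OF p])
  have "(\<integral>\<^sup>+\<omega>. ennreal ((R \<omega> * U \<omega> $ i) ^ k) \<partial>M)
      = (\<integral>\<^sup>+\<omega>. ennreal (R \<omega> ^ k) * ennreal ((U \<omega> $ i) ^ k) \<partial>M)"
    \<comment> \<open>As \<open>ennreal\<close> sends negative numbers to 0, the power is split only
      where \<open>R\<close> and the coordinates of \<open>U\<close> are nonnegative, which is
      almost everywhere.\<close>
    using radius_directionD(4)[OF RU] AE_direction[OF RU p]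
    by (intro nn_integral_cong_AE, eventually_elim) (simp add: power_mult_distrib ennreal_mult)
  also have "\<dots> = (\<integral>\<^sup>+x. ennreal (fst x ^ k) * ennreal ((snd x $ i) ^ k)
      \<partial>distr M (borel \<Otimes>\<^sub>M borel) (\<lambda>\<omega>. (R \<omega>, U \<omega>)))"
    by (subst nn_integral_distr) auto
  also have "\<dots> = (\<integral>\<^sup>+r. \<integral>\<^sup>+u. ennreal (r ^ k) * ennreal ((u $ i) ^ k) \<partial>lp_uniform_pos p \<partial>distr M borel R)"
    unfolding radius_direction_joint_law[OF RU]
    by (subst U.nn_integral_fst[symmetric]) auto
  also have "\<dots> = (\<integral>\<^sup>+r. ennreal (r ^ k) * ennreal (lp_moment p CARD('n) k) \<partial>distr M borel R)"
    using p by (simp add: nn_integral_cmult nn_integral_lp_uniform_pos)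
  also have "\<dots> = (\<integral>\<^sup>+r. ennreal (r ^ k) \<partial>distr M borel R) * ennreal (lp_moment p CARD('n) k)"
    by (rule nn_integral_multc) auto
  finally show ?thesis .
qed

section \<open>Copulas and the moments of the radius\<close>

lemma nn_integral_uniform_power:
  "(\<integral>\<^sup>+x. ennreal (x ^ k) \<partial>uniform_measure lborel {0<..<1::real}) = ennreal (1 / (real k + 1))"
proof -
  have "(\<integral>\<^sup>+x. ennreal (x ^ k) * indicator {0..1::real} x \<partial>lborel)
      = ennreal (1 ^ Suc k / (real k + 1) - 0 ^ Suc k / (real k + 1))"
  proof (rule nn_integral_FTC_Icc)
    show "((\<lambda>x. x ^ Suc k / (real k + 1)) has_real_derivative x ^ k) (at x)" for x
      by (rule DERIV_cong[OF DERIV_cdivide[OF DERIV_pow]]) (simp add: add.commute[of 1] add_pos_nonneg less_imp_neq[symmetric])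
  qed auto
  moreover have "(\<integral>\<^sup>+x. ennreal (x ^ k) * indicator {0<..<1::real} x \<partial>lborel)
      = (\<integral>\<^sup>+x. ennreal (x ^ k) * indicator {0..1::real} x \<partial>lborel)"
    using AE_lborel_singleton[of 0] AE_lborel_singleton[of 1]
    by (intro nn_integral_cong_AE, eventually_elim) (auto simp: indicator_def)
  ultimately show ?thesis
    by (subst nn_integral_uniform_measure) (auto simp: divide_ennreal_def)
qed

lemma real_distribution_uniform: "real_distribution (uniform_measure lborel {0<..<1::real})"
  by (auto intro!: real_distribution.intro prob_space_uniform_measure simp: real_distribution_axioms_def)

text \<open>The moments are those that uniform marginals force on the radius. The bound comes from
  the norm of points of the unit cube; it need not be sharp, but it is available before the law is
  known and lets the moments determine it.\<close>

definition radius_law :: "real \<Rightarrow> nat \<Rightarrow> real measure \<Rightarrow> bool"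
  where "radius_law p n \<rho> \<longleftrightarrow> real_distribution \<rho> \<and>
    (AE x in \<rho>. 0 \<le> x \<and> x \<le> real n powr (1 / p)) \<and>
    (\<forall>k. (\<integral>\<^sup>+x. ennreal (x ^ k) \<partial>\<rho>) = ennreal (1 / ((real k + 1) * lp_moment p n k)))"

lemma radius_law_unique: "radius_law p n \<rho> \<Longrightarrow> radius_law p n \<rho>' \<Longrightarrow> \<rho> = \<rho>'"
  unfolding radius_law_def by (elim conjE, rule moment_problem_bounded) auto

lemma radius_law_of_copula:
  fixes U :: "'a \<Rightarrow> real ^ 'n"
  assumes RU: "radius_direction M p R U" and p: "p > 0"
    and cop: "copula (distr M borel (\<lambda>\<omega>. R \<omega> *\<^sub>R U \<omega>))"
  shows "radius_law p CARD('n) (distr M borel R)"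
  unfolding radius_law_def
proof (intro conjI allI)
  note [measurable] = radius_directionD(2,3)[OF RU]
  interpret prob_space M by (rule radius_directionD(1)[OF RU])
  show "real_distribution (distr M borel R)"
    by (rule real_distribution_distr) simp
  have "AE x in distr M borel (\<lambda>\<omega>. R \<omega> *\<^sub>R U \<omega>). \<forall>i. 0 \<le> x $ i \<and> x $ i \<le> 1"
    using cop by (simp add: copula_def)
  then have "AE \<omega> in M. \<forall>i. 0 \<le> (R \<omega> *\<^sub>R U \<omega>) $ i \<and> (R \<omega> *\<^sub>R U \<omega>) $ i \<le> 1"
    by (subst (asm) AE_distr_iff) auto
  then have "AE \<omega> in M. 0 \<le> R \<omega> \<and> R \<omega> \<le> real CARD('n) powr (1 / p)"
    using radius_directionD(4)[OF RU] AE_direction[OF RU p]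
  proof eventually_elim
    fix \<omega> assume *: "\<forall>i. 0 \<le> (R \<omega> *\<^sub>R U \<omega>) $ i \<and> (R \<omega> *\<^sub>R U \<omega>) $ i \<le> 1" "0 \<le> R \<omega>"
      "lp_norm p (U \<omega>) = 1 \<and> (\<forall>i. 0 \<le> U \<omega> $ i)"
    \<comment> \<open>The left side is \<open>R \<omega>\<close>, because \<open>U \<omega>\<close>
      has norm 1 and \<open>R \<omega>\<close> is nonnegative.\<close>
    have "lp_norm p (R \<omega> *\<^sub>R U \<omega>) \<le> real CARD('n) powr (1 / p)"
      using *(1) by (intro lp_norm_le_of_abs_le_1[OF p]) (auto simp: abs_le_iff)
    then show "0 \<le> R \<omega> \<and> R \<omega> \<le> real CARD('n) powr (1 / p)"
      using * by (simp add: lp_norm_scaleR[OF p])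
  qed
  then show "AE x in distr M borel R. 0 \<le> x \<and> x \<le> real CARD('n) powr (1 / p)"
    by (subst AE_distr_iff) auto
  fix k
  \<comment> \<open>The claim does not mention \<open>i\<close>: a single marginal already fixes all
    moments of the radius.\<close>
  fix i :: 'n
  let ?m = "lp_moment p CARD('n) k"
  have m: "?m > 0" using p by (intro lp_moment_pos) auto
  have "(\<integral>\<^sup>+x. ennreal (x ^ k) \<partial>distr M borel R) * ennreal ?m = (\<integral>\<^sup>+\<omega>. ennreal ((R \<omega> * U \<omega> $ i) ^ k) \<partial>M)"
    by (rule nn_integral_radius_direction_power[OF RU p, symmetric])
  also have "\<dots> = (\<integral>\<^sup>+x. ennreal (x ^ k) \<partial>distr (distr M borel (\<lambda>\<omega>. R \<omega> *\<^sub>R U \<omega>)) borel (\<lambda>x. x $ i))"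
    by (simp add: nn_integral_distr)
  also have "distr (distr M borel (\<lambda>\<omega>. R \<omega> *\<^sub>R U \<omega>)) borel (\<lambda>x. x $ i) = uniform_measure lborel {0<..<1}"
    using cop by (simp add: copula_def)
  also have "(\<integral>\<^sup>+x. ennreal (x ^ k) \<partial>uniform_measure lborel {0<..<1::real}) = ennreal (1 / (real k + 1))"
    by (rule nn_integral_uniform_power)
  finally have eq: "(\<integral>\<^sup>+x. ennreal (x ^ k) \<partial>distr M borel R) * ennreal ?m = ennreal (1 / (real k + 1))" .
  have "(\<integral>\<^sup>+x. ennreal (x ^ k) \<partial>distr M borel R) = (\<integral>\<^sup>+x. ennreal (x ^ k) \<partial>distr M borel R) * ennreal ?m * ennreal (1 / ?m)"
    using m by (simp add: mult.assoc ennreal_mult[symmetric])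
  also have "\<dots> = ennreal (1 / ((real k + 1) * ?m))"
    unfolding eq using m by (simp add: ennreal_mult[symmetric])
  finally show "(\<integral>\<^sup>+x. ennreal (x ^ k) \<partial>distr M borel R) = ennreal (1 / ((real k + 1) * ?m))" .
qed

section \<open>Realising a prescribed radius law\<close>

text \<open>Converse of \<open>radius_direction_joint_law\<close>. The product law evaluated on
  rectangles is the independence condition, and rectangles with one side \<open>UNIV\<close> yield
  the two marginals.\<close>

lemma radius_directionI_joint_law:
  fixes M :: "'a measure" and U :: "'a \<Rightarrow> real ^ 'n"
  assumes p: "p > 0" and \<rho>: "real_distribution \<rho>" "AE x in \<rho>. 0 \<le> x"
    and M: "prob_space M"
    and [measurable]: "R \<in> borel_measurable M" "U \<in> borel_measurable M"
    and joint: "distr M (borel \<Otimes>\<^sub>M borel) (\<lambda>\<omega>. (R \<omega>, U \<omega>)) = \<rho> \<Otimes>\<^sub>M lp_uniform_pos p"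
  shows "radius_direction M p R U" and "distr M borel R = \<rho>"
proof -
  let ?U = "lp_uniform_pos p :: (real ^ 'n) measure"
  interpret prob_space M by fact
  interpret R: real_distribution \<rho> by fact
  interpret U: prob_space ?U by (rule prob_space_lp_uniform_pos[OF p])
  have space: "space ?U = UNIV"
    using sets_eq_imp_space_eq[OF sets_lp_uniform_pos] by auto
  have Times: "emeasure M ((R -` A \<inter> space M) \<inter> (U -` B \<inter> space M)) = emeasure \<rho> A * emeasure ?U B"
    if [measurable]: "A \<in> sets borel" "B \<in> sets borel" for A B
  proof -
    have "(R -` A \<inter> space M) \<inter> (U -` B \<inter> space M) = (\<lambda>\<omega>. (R \<omega>, U \<omega>)) -` (A \<times> B) \<inter> space M"
      by auto
    then have "emeasure M ((R -` A \<inter> space M) \<inter> (U -` B \<inter> space M))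
        = emeasure (distr M (borel \<Otimes>\<^sub>M borel) (\<lambda>\<omega>. (R \<omega>, U \<omega>))) (A \<times> B)"
      by (simp add: emeasure_distr)
    also have "\<dots> = emeasure \<rho> A * emeasure ?U B"
      unfolding joint by (rule U.emeasure_pair_measure_Times) auto
    finally show ?thesis .
  qed
  have R: "emeasure M (R -` A \<inter> space M) = emeasure \<rho> A" if "A \<in> sets borel" for A
    using Times[of A UNIV] that U.emeasure_space_1 space by (simp add: Int_absorb2)
  have U: "emeasure M (U -` B \<inter> space M) = emeasure ?U B" if "B \<in> sets borel" for B
    using Times[of UNIV B] that R.emeasure_space_1 by (simp add: Int_absorb1)
  show law_R: "distr M borel R = \<rho>"
    by (rule measure_eqI) (auto simp: emeasure_distr R)
  have law_U: "distr M borel U = ?U"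
    by (rule measure_eqI) (auto simp: emeasure_distr U)
  have "AE x in distr M borel R. 0 \<le> x" unfolding law_R by (rule \<rho>(2))
  then have pos: "AE \<omega> in M. 0 \<le> R \<omega>" by (subst (asm) AE_distr_iff) auto
  have "indep_set {R -` A \<inter> space M | A. A \<in> sets borel} {U -` B \<inter> space M | B. B \<in> sets borel}"
  proof (rule indep_setI)
    fix a b assume "a \<in> {R -` A \<inter> space M | A. A \<in> sets borel}" "b \<in> {U -` B \<inter> space M | B. B \<in> sets borel}"
    then obtain A B where AB: "a = R -` A \<inter> space M" "b = U -` B \<inter> space M" "A \<in> sets borel" "B \<in> sets borel"
      by auto
    then have "emeasure M (a \<inter> b) = emeasure M a * emeasure M b"
      using Times[of A B] by (simp only: R U)
    then show "prob (a \<inter> b) = prob a * prob b"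
      by (simp add: emeasure_eq_measure ennreal_mult[symmetric])
  qed auto
  then show "radius_direction M p R U"
    unfolding radius_direction_def using law_U pos M by auto
qed

text \<open>\<open>lp_spherical_pos\<close> takes its sample space of type \<open>(real \<times> real) ^ 'n\<close>: this is how
  \<open>real \<times> real ^ 'n\<close> is parsed. So \<open>(r, u)\<close> is encoded as the vector of the pairs \<open>(r, u\<^sub>i)\<close>.\<close>

lemma radius_direction_exists:
  assumes p: "p > 0" and \<rho>: "real_distribution \<rho>" "AE x in \<rho>. 0 \<le> x"
  obtains M :: "((real \<times> real) ^ 'n) measure" and R and U :: "(real \<times> real) ^ 'n \<Rightarrow> real ^ 'n"
  where "radius_direction M p R U" "distr M borel R = \<rho>"
proof -
  let ?U = "lp_uniform_pos p :: (real ^ 'n) measure"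
  let ?P = "\<rho> \<Otimes>\<^sub>M ?U"
  interpret R: real_distribution \<rho> by fact
  interpret U: prob_space ?U by (rule prob_space_lp_uniform_pos[OF p])
  interpret pair_prob_space \<rho> ?U ..
  define \<phi> :: "real \<times> (real ^ 'n) \<Rightarrow> (real \<times> real) ^ 'n" where "\<phi> x = (\<chi> i. (fst x, snd x $ i))" for x
  \<comment> \<open>Any index would do, since in the image of \<open>\<phi>\<close> every coordinate
    carries the same first component.\<close>
  define R where "R y = fst (y $ undefined)" for y :: "(real \<times> real) ^ 'n"
  define U where "U y = (\<chi> i. snd (y $ i))" for y :: "(real \<times> real) ^ 'n"
  have [measurable]: "R \<in> borel_measurable borel" "U \<in> borel_measurable borel"
    unfolding R_def [abs_def] U_def [abs_def]
    by (intro borel_measurable_continuous_onI continuous_intros)+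
  have sets_P: "sets ?P = sets (borel :: (real \<times> (real ^ 'n)) measure)"
    unfolding borel_prod[symmetric] by (intro sets_pair_measure_cong) auto
  have "\<phi> \<in> borel_measurable borel"
    unfolding \<phi>_def [abs_def] by (intro borel_measurable_continuous_onI continuous_intros)
  then have [measurable]: "\<phi> \<in> borel_measurable ?P"
    by (simp cong: measurable_cong_sets[OF sets_P refl])
  have prob: "prob_space (distr ?P borel \<phi>)"
    by (rule prob_space_distr) simp
  have pair: "(\<lambda>\<omega>. (R \<omega>, U \<omega>)) \<in> borel \<rightarrow>\<^sub>M borel \<Otimes>\<^sub>M borel"
    by measurable
  \<comment> \<open>Decoding after \<open>\<phi>\<close> is the identity, so the joint law is the
    product measure itself.\<close>
  have "distr (distr ?P borel \<phi>) (borel \<Otimes>\<^sub>M borel) (\<lambda>\<omega>. (R \<omega>, U \<omega>))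
      = distr ?P (borel \<Otimes>\<^sub>M borel) (\<lambda>x. x)"
    by (subst distr_distr[OF pair]) (auto simp: comp_def R_def U_def \<phi>_def)
  also have "\<dots> = ?P"
    by (rule distr_id2) (auto intro: sets_pair_measure_cong)
  finally have "distr (distr ?P borel \<phi>) (borel \<Otimes>\<^sub>M borel) (\<lambda>\<omega>. (R \<omega>, U \<omega>)) = ?P" .
  from radius_directionI_joint_law[OF p \<rho> prob _ _ this] show thesis
    by (intro that) auto
qed

text \<open>The prescribed moments of \<open>R\<close> cancel the moments of \<open>U $ i\<close>,
  which leaves \<open>1 / (k + 1)\<close>; \<open>moment_problem_bounded\<close> then identifies
  each marginal as uniform.\<close>

lemma copula_of_radius_law:
  fixes U :: "'a \<Rightarrow> real ^ 'n"
  assumes RU: "radius_direction M p R U" and p: "p > 0"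
    and law: "radius_law p CARD('n) (distr M borel R)"
  shows "copula (distr M borel (\<lambda>\<omega>. R \<omega> *\<^sub>R U \<omega>))"
proof -
  note [measurable] = radius_directionD(2,3)[OF RU]
  interpret prob_space M by (rule radius_directionD(1)[OF RU])
  let ?\<mu> = "distr M borel (\<lambda>\<omega>. R \<omega> *\<^sub>R U \<omega>)"
  \<comment> \<open>A common bound for the uniform law and for \<open>R * U $ i\<close>, as the
    moment problem asks for the same interval.\<close>
  let ?C = "max 1 (real CARD('n) powr (1 / p))"
  have "AE x in distr M borel R. 0 \<le> x \<and> x \<le> real CARD('n) powr (1 / p)"
    using law by (simp add: radius_law_def)
  then have R_bd: "AE \<omega> in M. 0 \<le> R \<omega> \<and> R \<omega> \<le> real CARD('n) powr (1 / p)"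
    by (subst (asm) AE_distr_iff) auto
  have marginal: "distr M borel (\<lambda>\<omega>. R \<omega> * U \<omega> $ i) = uniform_measure lborel {0<..<1}" for i
  proof (rule moment_problem_bounded)
    show "real_distribution (distr M borel (\<lambda>\<omega>. R \<omega> * U \<omega> $ i))"
      by (rule real_distribution_distr) simp
    show "real_distribution (uniform_measure lborel {0<..<1::real})"
      by (rule real_distribution_uniform)
    show "AE x in uniform_measure lborel {0<..<1::real}. 0 \<le> x \<and> x \<le> ?C"
      by (intro AE_uniform_measureI) auto
    have "AE \<omega> in M. 0 \<le> R \<omega> * U \<omega> $ i \<and> R \<omega> * U \<omega> $ i \<le> ?C"
      using R_bd AE_direction[OF RU p]
    proof eventually_elim
      fix \<omega> assume *: "0 \<le> R \<omega> \<and> R \<omega> \<le> real CARD('n) powr (1 / p)"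
        "lp_norm p (U \<omega>) = 1 \<and> (\<forall>i. 0 \<le> U \<omega> $ i)"
      have "R \<omega> * U \<omega> $ i \<le> R \<omega> * 1"
        using * abs_le_lp_norm[OF p, of "U \<omega>" i] by (intro mult_left_mono) auto
      then show "0 \<le> R \<omega> * U \<omega> $ i \<and> R \<omega> * U \<omega> $ i \<le> ?C"
        using * by auto
    qed
    then show "AE x in distr M borel (\<lambda>\<omega>. R \<omega> * U \<omega> $ i). 0 \<le> x \<and> x \<le> ?C"
      by (subst AE_distr_iff) auto
    fix k
    have "lp_moment p CARD('n) k > 0" using p by (intro lp_moment_pos) auto
    moreover have "(\<integral>\<^sup>+x. ennreal (x ^ k) \<partial>distr M borel R)
        = ennreal (1 / ((real k + 1) * lp_moment p CARD('n) k))"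
      using law by (simp add: radius_law_def)
    ultimately have "(\<integral>\<^sup>+\<omega>. ennreal ((R \<omega> * U \<omega> $ i) ^ k) \<partial>M) = ennreal (1 / (real k + 1))"
      unfolding nn_integral_radius_direction_power[OF RU p]
      by (simp add: ennreal_mult[symmetric])
    then show "(\<integral>\<^sup>+x. ennreal (x ^ k) \<partial>distr M borel (\<lambda>\<omega>. R \<omega> * U \<omega> $ i))
        = (\<integral>\<^sup>+x. ennreal (x ^ k) \<partial>uniform_measure lborel {0<..<1})"
      by (simp add: nn_integral_distr nn_integral_uniform_power)
  qed
  \<comment> \<open>The bound on \<open>R\<close> may exceed 1, so membership in the unit cube is
    read off from the marginals.\<close>
  have "AE \<omega> in M. 0 \<le> R \<omega> * U \<omega> $ i \<and> R \<omega> * U \<omega> $ i \<le> 1" for i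
  proof -
    have "AE x in distr M borel (\<lambda>\<omega>. R \<omega> * U \<omega> $ i). 0 \<le> x \<and> x \<le> 1"
      unfolding marginal by (intro AE_uniform_measureI) auto
    then show ?thesis by (subst (asm) AE_distr_iff) auto
  qed
  then have "AE \<omega> in M. \<forall>i. 0 \<le> R \<omega> * U \<omega> $ i \<and> R \<omega> * U \<omega> $ i \<le> 1"
    by (simp add: AE_all_countable)
  then have "AE x in ?\<mu>. \<forall>i. 0 \<le> x $ i \<and> x $ i \<le> 1"
    by (subst AE_distr_iff) auto
  moreover have "prob_space ?\<mu>" by (rule prob_space_distr) simp
  moreover have "distr ?\<mu> borel (\<lambda>x. x $ i) = uniform_measure lborel {0<..<1}" for i
    using marginal[of i] by (simp add: distr_distr comp_def)
  ultimately show ?thesis by (auto simp: copula_def)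
qed

text \<open>For existence, \<open>\<rho>\<close> is realised as the law of a radius. For uniqueness,
  every candidate has radius law \<open>\<rho>\<close>, hence a fixed joint law of radius and
  direction, and is therefore the image \<open>?\<mu>\<close> of one product measure under
  scaling.\<close>

lemma ex1_copula_of_radius_law:
  assumes p: "p > 0" and law: "radius_law p CARD('n) \<rho>"
  shows "\<exists>!\<mu> :: (real ^ 'n) measure. copula \<mu> \<and> lp_spherical_pos p \<mu>"
proof (rule ex_ex1I)
  let ?U = "lp_uniform_pos p :: (real ^ 'n) measure"
  let ?\<mu> = "distr (\<rho> \<Otimes>\<^sub>M ?U) borel (\<lambda>\<omega>. fst \<omega> *\<^sub>R snd \<omega>)"
  have \<rho>: "real_distribution \<rho>" "AE x in \<rho>. 0 \<le> x"
    using law by (auto simp: radius_law_def)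
  obtain M :: "((real \<times> real) ^ 'n) measure" and R and U :: "(real \<times> real) ^ 'n \<Rightarrow> real ^ 'n"
    where RU: "radius_direction M p R U" "distr M borel R = \<rho>"
    by (rule radius_direction_exists[OF p \<rho>])
  have "copula (distr M borel (\<lambda>\<omega>. R \<omega> *\<^sub>R U \<omega>))"
    by (rule copula_of_radius_law[OF RU(1) p]) (simp add: RU(2) law)
  moreover have "lp_spherical_pos p (distr M borel (\<lambda>\<omega>. R \<omega> *\<^sub>R U \<omega>))"
    unfolding lp_spherical_pos_def by (intro exI conjI, rule RU(1), rule refl)
  ultimately show "\<exists>\<mu> :: (real ^ 'n) measure. copula \<mu> \<and> lp_spherical_pos p \<mu>" by blast
  have unique: "\<mu> = ?\<mu>" if \<mu>_asm: "copula \<mu> \<and> lp_spherical_pos p \<mu>" for \<mu> :: "(real ^ 'n) measure"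
  proof -
    obtain M :: "((real \<times> real) ^ 'n) measure" and R U
      where RU: "radius_direction M p R U" and \<mu>: "\<mu> = distr M borel (\<lambda>\<omega>. R \<omega> *\<^sub>R U \<omega>)"
      using \<mu>_asm by (auto simp: lp_spherical_pos_def)
    note [measurable] = radius_directionD(2,3)[OF RU]
    have "distr M borel R = \<rho>"
      using radius_law_of_copula[OF RU p] \<mu>_asm \<mu> law by (auto intro: radius_law_unique)
    then have joint: "distr M (borel \<Otimes>\<^sub>M borel) (\<lambda>\<omega>. (R \<omega>, U \<omega>)) = \<rho> \<Otimes>\<^sub>M ?U"
      using radius_direction_joint_law[OF RU] by simp
    have "?\<mu> = distr (distr M (borel \<Otimes>\<^sub>M borel) (\<lambda>\<omega>. (R \<omega>, U \<omega>))) borel (\<lambda>\<omega>. fst \<omega> *\<^sub>R snd \<omega>)"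
      by (simp add: joint)
    also have "\<dots> = \<mu>" by (subst distr_distr) (auto simp: \<mu> comp_def)
    finally show ?thesis ..
  qed
  show "\<mu> = \<nu>" if "copula \<mu> \<and> lp_spherical_pos p \<mu>" "copula \<nu> \<and> lp_spherical_pos p \<nu>"
    for \<mu> \<nu> :: "(real ^ 'n) measure"
    using unique[OF that(1)] unique[OF that(2)] by simp
qed

section \<open>The law of the radius\<close>

lemma Gamma_plus1_pos: "x > 0 \<Longrightarrow> Gamma (x + 1) = x * Gamma (x :: real)"
  by (rule Gamma_plus1) (auto dest: nonpos_Ints_nonpos)

text \<open>For \<open>p = n - 1\<close> the Gamma arguments \<open>n / p\<close> and
  \<open>(n + k) / p\<close> exceed \<open>1 / p\<close> and \<open>(k + 1) / p\<close> by exactly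
  1. The functional equation gives \<open>lp_moment p n k = 1 / (k + 1)\<close>, so all moments of
  the radius are 1.\<close>

lemma radius_law_return_1:
  assumes p: "p > 0" "p = real n - 1"
  shows "radius_law p n (return borel 1)"
  unfolding radius_law_def
proof (intro conjI allI)
  show "real_distribution (return borel 1)"
    by (auto intro!: real_distribution.intro prob_space_return simp: real_distribution_axioms_def)
  have "1 \<le> real n powr (1 / p)"
    using p by (intro ge_one_powr_ge_zero) auto
  then show "AE x in return borel 1. 0 \<le> x \<and> x \<le> real n powr (1 / p)"
    by (subst AE_return) auto
  fix k
  have pos: "Gamma ((real k + 1) / p) > 0" "Gamma (1 / p) > 0"
    using p by (auto intro!: Gamma_real_pos divide_pos_pos)
  have "real n / p = 1 / p + 1" "(real n + real k) / p = (real k + 1) / p + 1"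
    using p by (auto simp: field_simps)
  then have Gamma_n: "Gamma (real n / p) = 1 / p * Gamma (1 / p)"
    "Gamma ((real n + real k) / p) = (real k + 1) / p * Gamma ((real k + 1) / p)"
    using p by (simp_all only: Gamma_plus1_pos divide_pos_pos zero_less_one add_nonneg_pos of_nat_0_le_iff)
  \<comment> \<open>Here \<open>x\<close> and \<open>y\<close> stand for
    \<open>Gamma (1 / p)\<close> and \<open>Gamma ((k + 1) / p)\<close>, and \<open>c\<close> for
    \<open>k + 1\<close>.\<close>
  have cancel: "c * (y * (1 / p * x) / (x * (c / p * y))) = 1" if "x > 0" "y > 0" "c > 0" for c x y :: real
    using that p(1) by simp
  have "(real k + 1) * lp_moment p n k = 1"
    unfolding lp_moment_def Gamma_n by (rule cancel) (use pos in auto)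
  then show "(\<integral>\<^sup>+x. ennreal (x ^ k) \<partial>return borel 1) = ennreal (1 / ((real k + 1) * lp_moment p n k))"
    by (simp add: nn_integral_return)
qed

section \<open>The Beta distribution and the moments of its root\<close>

definition beta_law :: "real \<Rightarrow> real \<Rightarrow> real measure"
  where "beta_law a b = density lborel (\<lambda>x. ennreal (beta_density a b x))"

lemma measurable_beta_density [measurable]: "beta_density a b \<in> borel_measurable borel"
  unfolding beta_density_def [abs_def] by measurable

lemma sets_beta_law [simp, measurable_cong]: "sets (beta_law a b) = sets borel"
  by (simp add: beta_law_def)

lemma beta_density_nonneg: "a > 0 \<Longrightarrow> b > 0 \<Longrightarrow> beta_density a b x \<ge> 0"
  unfolding beta_density_def
  by (intro mult_nonneg_nonneg divide_nonneg_nonneg less_imp_le[OF Gamma_real_pos]) auto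

lemma AE_beta_law: "AE x in beta_law a b. 0 < x \<and> x < 1"
  unfolding beta_law_def
  by (subst AE_density) (auto simp: beta_density_def indicator_def)

text \<open>The factor \<open>x powr s\<close> shifts the first parameter to \<open>a + s\<close>,
  so the value is \<open>Beta (a + s) b / Beta a b\<close>. A real exponent is needed because the
  moments of the \<open>p\<close>-th root use \<open>s = k / p\<close>.\<close>

lemma nn_integral_beta_law_powr:
  assumes ab: "a > 0" "b > 0" and s: "s \<ge> 0"
  shows "(\<integral>\<^sup>+x. ennreal (x powr s) \<partial>beta_law a b)
    = ennreal (Gamma (a + b) * Gamma (a + s) / (Gamma a * Gamma (a + s + b)))"
proof -
  let ?c = "Gamma (a + b) / (Gamma a * Gamma b)"
  have pos: "Gamma (a + b) > 0" "Gamma a > 0" "Gamma b > 0" "Gamma (a + s) > 0" "Gamma (a + s + b) > 0"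
    using assms by (auto intro!: Gamma_real_pos)
  have c: "?c \<ge> 0" using pos by simp
  have "(\<integral>\<^sup>+x. ennreal (x powr s) \<partial>beta_law a b)
      = (\<integral>\<^sup>+x. ennreal (beta_density a b x) * ennreal (x powr s) \<partial>lborel)"
    unfolding beta_law_def by (subst nn_integral_density) auto
  also have "\<dots> = (\<integral>\<^sup>+x. ennreal ?c
      * ennreal (indicator {0<..<1} x * (x powr (a + s - 1) * (1 - x) powr (b - 1))) \<partial>lborel)"
  proof (intro nn_integral_cong)
    fix x :: real
    have "beta_density a b x * x powr s = ?c * (indicator {0<..<1} x * (x powr (a + s - 1) * (1 - x) powr (b - 1)))"
    proof -
      have "x powr (a + s - 1) = x powr (a - 1) * x powr s"
        by (simp add: powr_add[symmetric] algebra_simps)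
      then show ?thesis by (simp only: beta_density_def mult_ac)
    qed
    then show "ennreal (beta_density a b x) * ennreal (x powr s)
      = ennreal ?c * ennreal (indicator {0<..<1} x * (x powr (a + s - 1) * (1 - x) powr (b - 1)))"
      using c beta_density_nonneg[OF ab] by (simp only: ennreal_mult'[symmetric])
  qed
  also have "\<dots> = ennreal ?c * ennreal (Beta (a + s) b)"
    using assms by (subst nn_integral_cmult) (auto simp: nn_integral_Beta)
  also have "\<dots> = ennreal (?c * Beta (a + s) b)"
    using c by (rule ennreal_mult'[symmetric])
  also have "?c * Beta (a + s) b = Gamma (a + b) * Gamma (a + s) / (Gamma a * Gamma (a + s + b))"
    using pos by (simp add: Beta_def field_simps)
  finally show ?thesis .
qed

lemma prob_space_beta_law:
  assumes ab: "a > 0" "b > 0"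
  shows "prob_space (beta_law a b)"
proof (rule prob_spaceI)
  have "emeasure (beta_law a b) (space (beta_law a b)) = (\<integral>\<^sup>+x. 1 \<partial>beta_law a b)"
    by simp
  \<comment> \<open>Only almost everywhere, since \<open>0 powr 0 = 0\<close>.\<close>
  also have "\<dots> = (\<integral>\<^sup>+x. ennreal (x powr 0) \<partial>beta_law a b)"
    using AE_beta_law[of a b] by (intro nn_integral_cong_AE, eventually_elim) simp
  also have "\<dots> = 1"
    unfolding nn_integral_beta_law_powr[OF ab order_refl]
    using less_imp_neq[OF Gamma_real_pos[of a]] less_imp_neq[OF Gamma_real_pos[of "a + b"]] ab by simp
  finally show "emeasure (beta_law a b) (space (beta_law a b)) = 1" .
qed

text \<open>The second parameter is positive exactly because \<open>p > n - 1\<close>, and it makes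
  the parameters add up to \<open>1 / p + 1\<close>. After the shift by \<open>k / p\<close> the sum
  is \<open>(k + 1) / p + 1\<close>, and the functional equation of Gamma supplies the factor
  \<open>k + 1\<close> in the denominator of the required moment.\<close>

lemma radius_law_beta:
  assumes p: "p > 0" "p > real n - 1" and n: "n > 0"
  shows "radius_law p n (distr (beta_law (real n / p) (1 - (real n - 1) / p)) borel (\<lambda>x. x powr (1 / p)))"
  unfolding radius_law_def
proof (intro conjI allI)
  let ?a = "real n / p" and ?b = "1 - (real n - 1) / p"
  have ab: "?a > 0" "?b > 0" using assms by auto
  interpret prob_space "beta_law ?a ?b" by (rule prob_space_beta_law[OF ab])
  show "real_distribution (distr (beta_law ?a ?b) borel (\<lambda>x. x powr (1 / p)))"
    by (rule real_distribution_distr) simp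
  have 1: "1 \<le> real n powr (1 / p)"
    using p n by (intro ge_one_powr_ge_zero) auto
  have "AE x in beta_law ?a ?b. 0 \<le> x powr (1 / p) \<and> x powr (1 / p) \<le> real n powr (1 / p)"
    using AE_beta_law[of ?a ?b]
  proof eventually_elim
    fix x :: real assume "0 < x \<and> x < 1"
    then have "x powr (1 / p) \<le> 1" using p by (intro powr_le1) auto
    with 1 show "0 \<le> x powr (1 / p) \<and> x powr (1 / p) \<le> real n powr (1 / p)" by auto
  qed
  then show "AE x in distr (beta_law ?a ?b) borel (\<lambda>x. x powr (1 / p)). 0 \<le> x \<and> x \<le> real n powr (1 / p)"
    by (subst AE_distr_iff) auto
  fix k
  have "(\<integral>\<^sup>+x. ennreal (x ^ k) \<partial>distr (beta_law ?a ?b) borel (\<lambda>x. x powr (1 / p)))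
      = (\<integral>\<^sup>+x. ennreal ((x powr (1 / p)) ^ k) \<partial>beta_law ?a ?b)"
    by (simp add: nn_integral_distr)
  also have "\<dots> = (\<integral>\<^sup>+x. ennreal (x powr (real k / p)) \<partial>beta_law ?a ?b)"
    using AE_beta_law[of ?a ?b]
    by (intro nn_integral_cong_AE, eventually_elim) (auto simp: powr_powr powr_realpow[symmetric])
  also have "\<dots> = ennreal (Gamma (?a + ?b) * Gamma (?a + real k / p) / (Gamma ?a * Gamma (?a + real k / p + ?b)))"
    using ab p by (intro nn_integral_beta_law_powr) auto
  also have "?a + ?b = 1 / p + 1" using p by (simp add: field_simps)
  also have "?a + real k / p + ?b = (real k + 1) / p + 1" using p by (simp add: field_simps)
  also have "?a + real k / p = (real n + real k) / p" by (simp add: add_divide_distrib)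
  also have "Gamma (1 / p + 1) = 1 / p * Gamma (1 / p)"
    using p by (intro Gamma_plus1_pos) auto
  also have "Gamma ((real k + 1) / p + 1) = (real k + 1) / p * Gamma ((real k + 1) / p)"
    using p by (intro Gamma_plus1_pos) auto
  also have "1 / p * Gamma (1 / p) * Gamma ((real n + real k) / p)
      / (Gamma ?a * ((real k + 1) / p * Gamma ((real k + 1) / p)))
      = 1 / ((real k + 1) * lp_moment p n k)"
    using p by (simp add: lp_moment_def)
  finally show "(\<integral>\<^sup>+x. ennreal (x ^ k) \<partial>distr (beta_law ?a ?b) borel (\<lambda>x. x powr (1 / p)))
      = ennreal (1 / ((real k + 1) * lp_moment p n k))" .
qed

section \<open>The density of the radius\<close>

text \<open>The substitution \<open>r = x powr (1 / p)\<close> is read as an image measure: it sends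
  Lebesgue measure on the positive half-line to a power law with exponent \<open>p\<close>, whose
  density is already known.\<close>

lemma nn_integral_powr_substitution:
  fixes f :: "real \<Rightarrow> ennreal"
  assumes [measurable]: "f \<in> borel_measurable borel" and p: "p > 0"
  shows "(\<integral>\<^sup>+x. indicator {0<..} x * f (x powr (1 / p)) \<partial>lborel)
    = (\<integral>\<^sup>+r. ennreal (indicator {0<..} r * (p * r powr (p - 1))) * f r \<partial>lborel)"
proof -
  let ?N = "distr (density lborel (indicator {0<..} :: real \<Rightarrow> ennreal)) borel (\<lambda>x. x powr (1 / p))"
  have "?N = density lborel (\<lambda>r. 1 * ennreal (indicator {0<..} r * (p * r powr (p - 1))))"
  proof (rule power_law_density)
    fix y :: real
    have [measurable]: "(\<lambda>x. x powr (1 / p)) -` {..<y} \<in> sets (borel :: real measure)"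
      by (rule measurable_sets_borel[of _ borel]) measurable
    have "{0<..} \<inter> (\<lambda>x. x powr (1 / p)) -` {..<y} = (if y \<le> 0 then {} else {0<..<y powr p})"
      using p by (auto simp: powr_less_iff)
    moreover have "emeasure ?N {..<y} = (\<integral>\<^sup>+x. indicator ({0<..} \<inter> (\<lambda>x. x powr (1 / p)) -` {..<y}) x \<partial>lborel)"
      by (simp add: emeasure_distr emeasure_density indicator_inter_arith)
    ultimately have "emeasure ?N {..<y} = emeasure lborel (if y \<le> 0 then {} else {0<..<y powr p})"
      by (simp only:) (subst nn_integral_indicator, auto)
    then show "emeasure ?N {..<y} = 1 * ennreal (if y \<le> 0 then 0 else y powr p)"
      by simp
  qed (use p in auto)
  moreover have "(\<integral>\<^sup>+r. f r \<partial>?N) = (\<integral>\<^sup>+x. indicator {0<..} x * f (x powr (1 / p)) \<partial>lborel)"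
    by (simp add: nn_integral_distr nn_integral_density)
  ultimately show ?thesis
    by (simp add: nn_integral_density)
qed

lemma distr_beta_law_powr:
  assumes p: "p > 0"
  shows "distr (beta_law a b) borel (\<lambda>x. x powr (1 / p))
    = density lborel (\<lambda>r. ennreal (p * r powr (p - 1) * beta_density a b (r powr p) * indicator {0<..} r))"
proof (rule measure_eqI)
  fix A assume "A \<in> sets (distr (beta_law a b) borel (\<lambda>x. x powr (1 / p)))"
  then have [measurable]: "A \<in> sets borel" by simp
  have [measurable]: "(\<lambda>x. x powr (1 / p)) -` A \<in> sets (borel :: real measure)"
    by (rule measurable_sets_borel[of _ borel]) measurable
  have "emeasure (distr (beta_law a b) borel (\<lambda>x. x powr (1 / p))) A
      = (\<integral>\<^sup>+x. ennreal (beta_density a b x) * indicator ((\<lambda>x. x powr (1 / p)) -` A) x \<partial>lborel)"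
    by (subst emeasure_distr) (auto simp: beta_law_def emeasure_density)
  \<comment> \<open>The indicator is harmless because \<open>beta_density\<close> vanishes outside
    \<open>(0, 1)\<close>; for positive \<open>x\<close> the two powers undo each other.\<close>
  also have "\<dots> = (\<integral>\<^sup>+x. indicator {0<..} x
      * (ennreal (beta_density a b ((x powr (1 / p)) powr p)) * indicator A (x powr (1 / p))) \<partial>lborel)"
    using p by (intro nn_integral_cong) (auto simp: beta_density_def indicator_def powr_powr)
  also have "\<dots> = (\<integral>\<^sup>+r. ennreal (indicator {0<..} r * (p * r powr (p - 1)))
      * (ennreal (beta_density a b (r powr p)) * indicator A r) \<partial>lborel)"
    using p by (intro nn_integral_powr_substitution) auto
  also have "\<dots> = (\<integral>\<^sup>+r. ennreal (p * r powr (p - 1) * beta_density a b (r powr p) * indicator {0<..} r)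
      * indicator A r \<partial>lborel)"
    using p by (intro nn_integral_cong) (auto simp: indicator_def ennreal_mult'[symmetric])
  finally show "emeasure (distr (beta_law a b) borel (\<lambda>x. x powr (1 / p))) A
      = emeasure (density lborel (\<lambda>r. ennreal (p * r powr (p - 1) * beta_density a b (r powr p) * indicator {0<..} r))) A"
    by (simp add: emeasure_density)
qed simp

text \<open>The powers of \<open>r\<close> combine by
  \<open>p - 1 + p * (n / p - 1) = n - 1\<close>. The Jacobian factor \<open>p\<close> cancels
  against \<open>Gamma (1 / p + 1) = 1 / p * Gamma (1 / p)\<close>.\<close>

lemma radius_density_eq:
  assumes p: "p > 0" and n: "n > 0"
  shows "p * r powr (p - 1) * beta_density (real n / p) (1 - (real n - 1) / p) (r powr p) * indicator {0<..} r
    = Gamma (1 / p) / (Gamma (real n / p) * Gamma (1 - (real n - 1) / p))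
      * r ^ (n - 1) * (1 - r powr p) powr (- ((real n - 1) / p)) * indicator {0<..<1} r"
proof (cases "0 < r \<and> r < 1")
  case True
  have "real n / p + (1 - (real n - 1) / p) = 1 / p + 1" using p by (simp add: field_simps)
  then have Gamma: "Gamma (real n / p + (1 - (real n - 1) / p)) = 1 / p * Gamma (1 / p)"
    using p by (simp only: Gamma_plus1_pos divide_pos_pos zero_less_one)
  have lt: "r powr p < 1" using True p by (simp add: powr_less_iff)
  have "p - 1 + p * (real n / p - 1) = real (n - 1)" using p n by (simp add: field_simps of_nat_diff)
  then have powr: "r powr (p - 1) * (r powr p) powr (real n / p - 1) = r ^ (n - 1)"
    using True by (simp add: powr_powr powr_add[symmetric] powr_realpow)
  show ?thesis
    unfolding beta_density_def Gamma powr[symmetric] using True lt p by (simp add: mult_ac)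
next
  case False
  have "beta_density a b (r powr p) = 0" if "1 \<le> r" for a b
    using that ge_one_powr_ge_zero[of r p] p by (auto simp: beta_density_def)
  with False show ?thesis by (auto simp: indicator_def)
qed

section \<open>Existence, uniqueness and the radius in the cases p > n - 1 and p = n - 1\<close>

theorem theorem10:
  fixes p :: real and M :: "'a measure" and R :: "'a \<Rightarrow> real" and U :: "'a \<Rightarrow> real ^ 'n"
  assumes "CARD('n) \<ge> 2" and "p \<ge> 1" and "p \<ge> real CARD('n) - 1"
  shows "(\<exists>!\<mu> :: (real ^ 'n) measure. copula \<mu> \<and> lp_spherical_pos p \<mu>) \<and>
    (radius_direction M p R U \<and> copula (distr M borel (\<lambda>\<omega>. R \<omega> *\<^sub>R U \<omega>)) \<longrightarrow>
      (p > real CARD('n) - 1 \<longrightarrow>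
        distributed M lborel (\<lambda>\<omega>. R \<omega> powr p)
          (\<lambda>x. ennreal (beta_density (real CARD('n) / p) (1 - (real CARD('n) - 1) / p) x)) \<and>
        distributed M lborel R
          (\<lambda>r. ennreal (Gamma (1 / p)
              / (Gamma (real CARD('n) / p) * Gamma (1 - (real CARD('n) - 1) / p))
            * r ^ (CARD('n) - 1) * (1 - r powr p) powr (- ((real CARD('n) - 1) / p))
            * indicator {0<..<1} r))) \<and>
      (p = real CARD('n) - 1 \<longrightarrow>
        (AE \<omega> in M. R \<omega> = 1) \<and> (AE \<omega> in M. R \<omega> *\<^sub>R U \<omega> = U \<omega>)))"
proof (intro conjI impI; (elim conjE)?)
  let ?n = "CARD('n)"
  let ?a = "real ?n / p" and ?b = "1 - (real ?n - 1) / p"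
  let ?\<rho> = "distr (beta_law ?a ?b) borel (\<lambda>x. x powr (1 / p))"
  have p: "p > 0" using assms by simp
  have beta: "radius_law p ?n ?\<rho>" if "p > real ?n - 1"
    using p that by (intro radius_law_beta) auto
  have dirac: "radius_law p ?n (return borel 1)" if "p = real ?n - 1"
    using p that by (intro radius_law_return_1)
  show "\<exists>!\<mu> :: (real ^ 'n) measure. copula \<mu> \<and> lp_spherical_pos p \<mu>"
  proof (cases "p = real ?n - 1")
    case True
    show ?thesis by (rule ex1_copula_of_radius_law[OF p dirac[OF True]])
  next
    case False
    then have "p > real ?n - 1" using assms by simp
    then show ?thesis by (intro ex1_copula_of_radius_law[OF p beta])
  qed
  assume RU: "radius_direction M p R U" and cop: "copula (distr M borel (\<lambda>\<omega>. R \<omega> *\<^sub>R U \<omega>))"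
  note [measurable] = radius_directionD(2,3)[OF RU]
  \<comment> \<open>Any representation of a copula has a radius with these moments, so
    \<open>radius_law_unique\<close> identifies its law with the candidate \<open>?\<rho>\<close> or
    with the point mass at 1.\<close>
  have law: "radius_law p ?n (distr M borel R)"
    by (rule radius_law_of_copula[OF RU p cop])
  {
    assume "p > real ?n - 1"
    then have R: "distr M borel R = ?\<rho>"
      using law beta by (intro radius_law_unique)
    \<comment> \<open>\<open>distributed\<close> refers to \<open>lborel\<close>, which has the same
      measurable sets as \<open>borel\<close>. Raising the \<open>p\<close>-th root to the power
      \<open>p\<close> returns the Beta variable, almost everywhere since it is positive.\<close>
    have "distr M lborel (\<lambda>\<omega>. R \<omega> powr p) = distr (distr M borel R) borel (\<lambda>x. x powr p)"
      by (subst distr_distr) (auto simp: comp_def intro!: distr_cong)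
    also have "\<dots> = distr (beta_law ?a ?b) borel (\<lambda>x. (x powr (1 / p)) powr p)"
      unfolding R by (subst distr_distr) (auto simp: comp_def)
    also have "\<dots> = distr (beta_law ?a ?b) borel (\<lambda>x. x)"
    proof (rule distr_cong_AE)
      show "AE x in beta_law ?a ?b. (x powr (1 / p)) powr p = x"
        using AE_beta_law[of ?a ?b] by eventually_elim (use p in \<open>auto simp: powr_powr\<close>)
    qed auto
    also have "\<dots> = beta_law ?a ?b"
      by (rule distr_id2) simp
    finally show "distributed M lborel (\<lambda>\<omega>. R \<omega> powr p) (\<lambda>x. ennreal (beta_density ?a ?b x))"
      by (simp add: distributed_def beta_law_def)
    have "distr M lborel R = distr M borel R"
      by (rule distr_cong) auto
    also have "\<dots> = density lborel (\<lambda>r. ennreal (Gamma (1 / p) / (Gamma ?a * Gamma ?b)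
        * r ^ (?n - 1) * (1 - r powr p) powr (- ((real ?n - 1) / p)) * indicator {0<..<1} r))"
      unfolding R distr_beta_law_powr[OF p] by (subst radius_density_eq[OF p]) auto
    finally show "distributed M lborel R (\<lambda>r. ennreal (Gamma (1 / p) / (Gamma ?a * Gamma ?b)
        * r ^ (?n - 1) * (1 - r powr p) powr (- ((real ?n - 1) / p)) * indicator {0<..<1} r))"
      by (simp add: distributed_def)
  }
  assume "p = real ?n - 1"
  then have R: "distr M borel R = return borel 1"
    using law dirac by (intro radius_law_unique)
  have "AE x in distr M borel R. x = 1"
    unfolding R by (subst AE_return) auto
  then show "AE \<omega> in M. R \<omega> = 1" by (subst (asm) AE_distr_iff) auto
  then show "AE \<omega> in M. R \<omega> *\<^sub>R U \<omega> = U \<omega>" by eventually_elim simp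
qed

end
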